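(* As the parameter $\epsilon$ approaches zero, with the mesh size $\Delta x$ and the time step $\Delta t$ remaining unchanged, the fully discrete first-order IMEX $P_N$ scheme (L) for the one-dimensional linear radiative transfer equation, written out in the context, reduces to an implicit five-point scheme for the diffusion limit equation $$\frac1c\,\frac{\partial I^{(0)}}{\partial t}-\frac{\partial}{\partial x}\Big(\frac{1}{3\sigma_s}\,\frac{\partial I^{(0)}}{\partial x}\Big)=-\sigma_a I^{(0)} .$$
   Context: **Model.** The one-dimensional linear radiative transfer equation (without source) for the radiation intensity $I(t,x,\mu)$ is $$\frac{\epsilon^2}{c}\partial_t I+\epsilon\mu\,\partial_x I=\sigma_s\Big(\frac12\int_{-1}^1 I\,d\mu-I\Big)-\epsilon^2\sigma_a I,\qquad \mu\in[-1,1],$$ where $c$ is the speed of light, and $\sigma_s$ and $\sigma_a$ are the (constant) scattering and absorption coefficients. Its $P_N$ approximation of truncation order $M$ uses the moments $I_l=\int_{-1}^1P_l(\mu)I\,d\mu$, $l=0,\dots,M$, where $P_l$ are the Legendre polynomials, with the closure $I_{M+1}=0$. As $\epsilon\to0$ the intensity $I$ reduces to $I^{(0)}=\frac12\int_{-1}^1 I\,d\mu$, which is the unknown of the diffusion limit equation. **Notation.** $a_{l-1}=\frac{l}{2l+1}$ and $b_{l+1}=\frac{l+1}{2l+1}$ for $l\ge1$. The spatial mesh is uniform with mesh size $\Delta x$, and the time step is $\Delta t$. $I^n_{l,i}$ is the numerical value of $I_l$ in cell $i$ at time level $n$, $\hat I^n_{1,i}=I^n_{1,i}/\epsilon$, $I^n_{M+1,i}=0$,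 and $v_{\max}=1$ is the wave speed in the local Lax–Friedrichs flux. **Scheme (L).** For each cell $i$: $$\frac1c\frac{I_{0,i}^{n+1}-I_{0,i}^n}{\Delta t}+\frac{\hat I_{1,i+1}^{n+1}-\hat I_{1,i-1}^{n+1}}{2\Delta x}-\frac{v_{\max}}{2\Delta x}\big(I_{0,i+1}^{n+1}-2I_{0,i}^{n+1}+I_{0,i-1}^{n+1}\big)=-\sigma_aI_{0,i}^{n+1},$$ $$\frac{\epsilon^2}{c}\frac{\hat I_{1,i}^{n+1}-\hat I_{1,i}^n}{\Delta t}+a_0\frac{I_{0,i+1}^{n+1}-I_{0,i-1}^{n+1}}{2\Delta x}-\frac{\epsilon v_{\max}}{2\Delta x}\big(\hat I_{1,i+1}^{n+1}-2\hat I_{1,i}^{n+1}+\hat I_{1,i-1}^{n+1}\big)+b_2\frac{I_{2,i+1}^n-I_{2,i-1}^n}{2\Delta x}=-(\epsilon^2\sigma_a+\sigma_s)\hat I_{1,i}^{n+1},$$ and for $l=2,\dots,M$, $$\frac{\epsilon^2}{c}\frac{I_{l,i}^{n+1}-I_{l,i}^n}{\Delta t}+\epsilon a_{l-1}\frac{I_{l-1,i+1}^{n+1}-I_{l-1,i-1}^{n+1}}{2\Delta x}+\epsilon b_{l+1}\frac{I_{l+1,i+1}^n-I_{l+1,i-1}^n}{2\Delta x}-\frac{\epsilon v_{\max}}{2\Delta x}\big(I_{l,i+1}^n-2I_{l,i}^n+I_{l,i-1}^n\big)=-(\epsilon^2\sigma_a+\sigma_s)I_{l,i}^{n+1}.$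$
   Formalization: At the first time step the reduction is claimed only if the initial second moment tends to zero with epsilon (otherwise it fails); solution families are assumed bounded as epsilon tends to zero, or, on the infinite mesh, bounded for each epsilon with bounded, convergent initial data. *)

theory Defs
  imports "HOL-Analysis.Analysis"
begin

text \<open>
  A grid function is a map \<open>int \<Rightarrow> real\<close> (cell index to value). The moments of one discrete solution
  are given as \<open>I l n i\<close>: moment number \<open>l\<close>, time level \<open>n\<close>, cell \<open>i\<close>.
\<close>

definition v_max :: real where
  "v_max = 1"

text \<open>
  The two families are indexed by the moment they multiply, as in \<open>a_{l-1} = l / (2 l + 1)\<close> and
  \<open>b_{l+1} = (l + 1) / (2 l + 1)\<close>; the formulas below are these after shifting the index.
\<close>

definition pn_a :: "nat \<Rightarrow> real" where
  "pn_a k = (real k + 1) / (2 * real k + 3)"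

definition pn_b :: "nat \<Rightarrow> real" where
  "pn_b k = real k / (2 * real k - 1)"

lemma pn_a_shift: "l \<ge> 1 \<Longrightarrow> pn_a (l - 1) = real l / (2 * real l + 1)"
  by (simp add: pn_a_def of_nat_diff algebra_simps)

lemma pn_b_shift: "pn_b (l + 1) = (real l + 1) / (2 * real l + 1)"
  by (simp add: pn_b_def algebra_simps)

definition central_diff :: "real \<Rightarrow> (int \<Rightarrow> real) \<Rightarrow> int \<Rightarrow> real" where
  "central_diff \<Delta>x f i = (f (i + 1) - f (i - 1)) / (2 * \<Delta>x)"

definition lax_friedrichs :: "real \<Rightarrow> (int \<Rightarrow> real) \<Rightarrow> int \<Rightarrow> real" where
  "lax_friedrichs \<Delta>x f i = v_max / (2 * \<Delta>x) * (f (i + 1) - 2 * f i + f (i - 1))"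

text \<open>The rescaled first moment, which is the unknown of the scheme in place of \<open>I 1\<close>.\<close>

definition I1_hat :: "real \<Rightarrow> (nat \<Rightarrow> nat \<Rightarrow> int \<Rightarrow> real) \<Rightarrow> nat \<Rightarrow> int \<Rightarrow> real" where
  "I1_hat \<epsilon> I n i = I 1 n i / \<epsilon>"

text \<open>
  The scheme with truncation order \<open>M\<close>, imposed in the cells of the mesh \<open>C\<close>. Values outside \<open>C\<close>
  play the role of ghost values, so that no boundary condition is built in.
\<close>

definition imex_pn_scheme ::
  "real \<Rightarrow> real \<Rightarrow> real \<Rightarrow> real \<Rightarrow> real \<Rightarrow> nat \<Rightarrow> real \<Rightarrow> int set
    \<Rightarrow> (nat \<Rightarrow> nat \<Rightarrow> int \<Rightarrow> real) \<Rightarrow> bool" where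
  "imex_pn_scheme c \<sigma>\<^sub>s \<sigma>\<^sub>a \<Delta>x \<Delta>t M \<epsilon> C I \<longleftrightarrow>
     (\<forall>n i. I (M + 1) n i = 0) \<and>
     (\<forall>n. \<forall>i\<in>C.
        1 / c * ((I 0 (n + 1) i - I 0 n i) / \<Delta>t)
          + central_diff \<Delta>x (I1_hat \<epsilon> I (n + 1)) i
          - lax_friedrichs \<Delta>x (I 0 (n + 1)) i
        = - \<sigma>\<^sub>a * I 0 (n + 1) i) \<and>
     (\<forall>n. \<forall>i\<in>C.
        \<epsilon>\<^sup>2 / c * ((I1_hat \<epsilon> I (n + 1) i - I1_hat \<epsilon> I n i) / \<Delta>t)
          + pn_a 0 * central_diff \<Delta>x (I 0 (n + 1)) i
          - \<epsilon> * lax_friedrichs \<Delta>x (I1_hat \<epsilon> I (n + 1)) i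
          + pn_b 2 * central_diff \<Delta>x (I 2 n) i
        = - (\<epsilon>\<^sup>2 * \<sigma>\<^sub>a + \<sigma>\<^sub>s) * I1_hat \<epsilon> I (n + 1) i) \<and>
     (\<forall>l\<in>{2..M}. \<forall>n. \<forall>i\<in>C.
        \<epsilon>\<^sup>2 / c * ((I l (n + 1) i - I l n i) / \<Delta>t)
          + \<epsilon> * pn_a (l - 1) * central_diff \<Delta>x (I (l - 1) (n + 1)) i
          + \<epsilon> * pn_b (l + 1) * central_diff \<Delta>x (I (l + 1) n) i
          - \<epsilon> * lax_friedrichs \<Delta>x (I l n) i
        = - (\<epsilon>\<^sup>2 * \<sigma>\<^sub>a + \<sigma>\<^sub>s) * I l (n + 1) i)"

text \<open>
  The intensity \<open>I^(0)\<close> is the angular mean, i.e. half of the zeroth moment, since \<open>P_0 = 1\<close>.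
\<close>

definition mean_intensity :: "(nat \<Rightarrow> nat \<Rightarrow> int \<Rightarrow> real) \<Rightarrow> nat \<Rightarrow> int \<Rightarrow> real" where
  "mean_intensity I n i = I 0 n i / 2"

text \<open>
  Left-hand side minus right-hand side of the five-point scheme for the step from level \<open>n\<close> to
  \<open>n + 1\<close> in cell \<open>i\<close>. The diffusion term is the central difference applied twice, hence the
  mesh size \<open>2 * \<Delta>x\<close>; the remaining second difference is the numerical diffusion inherited from the
  Lax-Friedrichs flux, which is of first order in \<open>\<Delta>x\<close>.
\<close>

definition five_point_residual ::
  "real \<Rightarrow> real \<Rightarrow> real \<Rightarrow> real \<Rightarrow> real \<Rightarrow> (nat \<Rightarrow> int \<Rightarrow> real) \<Rightarrow> nat \<Rightarrow> int \<Rightarrow> real" where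
  "five_point_residual c \<sigma>\<^sub>s \<sigma>\<^sub>a \<Delta>x \<Delta>t U n i =
     1 / c * ((U (n + 1) i - U n i) / \<Delta>t)
       - 1 / (3 * \<sigma>\<^sub>s) * ((U (n + 1) (i + 2) - 2 * U (n + 1) i + U (n + 1) (i - 2)) / (2 * \<Delta>x)\<^sup>2)
       - v_max / (2 * \<Delta>x) * (U (n + 1) (i + 1) - 2 * U (n + 1) i + U (n + 1) (i - 1))
       + \<sigma>\<^sub>a * U (n + 1) i"

text \<open>Left-hand side minus right-hand side of the diffusion limit equation, for \<open>u t x\<close>.\<close>

definition diffusion_residual ::
  "real \<Rightarrow> real \<Rightarrow> real \<Rightarrow> (real \<Rightarrow> real \<Rightarrow> real) \<Rightarrow> real \<Rightarrow> real \<Rightarrow> real" where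
  "diffusion_residual c \<sigma>\<^sub>s \<sigma>\<^sub>a u t x =
     1 / c * deriv (\<lambda>s. u s x) t - deriv (\<lambda>y. 1 / (3 * \<sigma>\<^sub>s) * deriv (u t) y) x + \<sigma>\<^sub>a * u t x"

text \<open>Classical regularity: once continuously differentiable in time and twice in space.\<close>

definition C12_on :: "(real \<times> real) set \<Rightarrow> (real \<Rightarrow> real \<Rightarrow> real) \<Rightarrow> bool" where
  "C12_on S u \<longleftrightarrow>
     (\<forall>(t, x)\<in>S. (\<lambda>s. u s x) differentiable (at t) \<and> u t differentiable (at x)
        \<and> deriv (u t) differentiable (at x)) \<and>
     continuous_on S (\<lambda>(t, x). deriv (\<lambda>s. u s x) t) \<and>
     continuous_on S (\<lambda>(t, x). deriv (u t) x) \<and>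
     continuous_on S (\<lambda>(t, x). deriv (deriv (u t)) x)"

text \<open>
  A family of difference schemes, given by its residual \<open>R \<Delta>x \<Delta>t U n i\<close>, is consistent with a
  differential equation, given by its residual \<open>L u t x\<close>: inserting the grid values of a classical
  function into the scheme recovers \<open>L u\<close> as the mesh is refined, \<open>\<Delta>x\<close> and \<open>\<Delta>t\<close> tending to zero
  independently of each other.
\<close>

definition consistent_with ::
  "(real \<Rightarrow> real \<Rightarrow> (nat \<Rightarrow> int \<Rightarrow> real) \<Rightarrow> nat \<Rightarrow> int \<Rightarrow> real)
    \<Rightarrow> ((real \<Rightarrow> real \<Rightarrow> real) \<Rightarrow> real \<Rightarrow> real \<Rightarrow> real) \<Rightarrow> bool" where
  "consistent_with R L \<longleftrightarrow>
     (\<forall>S u t x. open S \<and> C12_on S u \<and> (t, x) \<in> S \<longrightarrow>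
        ((\<lambda>(\<Delta>x, \<Delta>t). R \<Delta>x \<Delta>t (\<lambda>n i. u (t + real n * \<Delta>t) (x + real_of_int i * \<Delta>x)) 0 0)
           \<longlongrightarrow> L u t x) (at_right 0 \<times>\<^sub>F at_right 0))"

end

theory Submission
  imports Defs
begin

text \<open>
  For fixed \<open>\<epsilon>\<close> the scheme gives \<open>I l (n + 1) = O(\<epsilon>)\<close> for \<open>l \<ge> 2\<close> and the discrete Fick law
  \<open>\<sigma>\<^sub>s * I1_hat + 1/3 * D (I 0) + 2/3 * D (I 2 n) = O(\<epsilon>)\<close>, where \<open>D\<close> is the central difference;
  inserting the latter into the equation for \<open>I 0\<close> turns the flux difference into \<open>D (D (I 0))\<close>.

  On the unbounded mesh the implicit five-point operator is diagonally dominant, so it has a maximum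
  principle. Eliminating \<open>I1_hat\<close> leaves a five-point equation for \<open>I 0\<close> perturbed by \<open>\<epsilon>\<close> times a
  bounded operator applied to \<open>I1_hat\<close>, so for small \<open>\<epsilon>\<close> the perturbation is absorbed and the sup
  norms stay bounded uniformly in \<open>\<epsilon>\<close>. Diagonal dominance also makes the values at different
  \<open>\<epsilon>\<close> a Cauchy family in each cell.
\<close>

subsection \<open>The implicit five-point operator\<close>

text \<open>The operator of one implicit time step. The coefficients are kept abstract because
  \<open>\<kappa>\<close> is \<open>1 / (3 * \<sigma>\<^sub>s * (2 * \<Delta>x)\<^sup>2)\<close> for
  the limit scheme, while for fixed \<open>\<epsilon>\<close> a coefficient depending on
  \<open>\<epsilon>\<close> takes the place of \<open>\<sigma>\<^sub>s\<close>.\<close>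

definition implicit_op :: "real \<Rightarrow> real \<Rightarrow> real \<Rightarrow> (int \<Rightarrow> real) \<Rightarrow> int \<Rightarrow> real" where
  "implicit_op \<alpha> \<kappa> \<nu> V i =
     \<alpha> * V i - \<kappa> * (V (i + 2) - 2 * V i + V (i - 2)) - \<nu> * (V (i + 1) - 2 * V i + V (i - 1))"

text \<open>Diagonal dominance: solved for the central value, the equation has nonnegative neighbour
  weights summing to \<open>2 * \<kappa> + 2 * \<nu>\<close>, which falls short of the diagonal
  weight by exactly \<open>\<alpha>\<close>.\<close>

lemma implicit_op_step:
  assumes "\<kappa> \<ge> 0" "\<nu> \<ge> 0"
    and "\<And>j. j \<in> {i - 2, i - 1, i + 1, i + 2} \<Longrightarrow> \<bar>V j\<bar> \<le> S"
  shows "(\<alpha> + 2 * \<kappa> + 2 * \<nu>) * \<bar>V i\<bar> \<le> \<bar>implicit_op \<alpha> \<kappa> \<nu> V i\<bar> + (2 * \<kappa> + 2 * \<nu>) * S"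
proof (cases "\<alpha> + 2 * \<kappa> + 2 * \<nu> \<ge> 0")
  case True
  have "(\<alpha> + 2 * \<kappa> + 2 * \<nu>) * V i
      = implicit_op \<alpha> \<kappa> \<nu> V i + (\<kappa> * (V (i + 2) + V (i - 2)) + \<nu> * (V (i + 1) + V (i - 1)))"
    by (simp add: implicit_op_def algebra_simps)
  moreover have "\<bar>\<kappa> * (V (i + 2) + V (i - 2))\<bar> \<le> \<kappa> * (2 * S)"
    using assms(1) assms(3)[of "i + 2"] assms(3)[of "i - 2"]
    unfolding abs_mult by (intro mult_mono) auto
  moreover have "\<bar>\<nu> * (V (i + 1) + V (i - 1))\<bar> \<le> \<nu> * (2 * S)"
    using assms(2) assms(3)[of "i + 1"] assms(3)[of "i - 1"]
    unfolding abs_mult by (intro mult_mono) auto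
  ultimately have "\<bar>(\<alpha> + 2 * \<kappa> + 2 * \<nu>) * V i\<bar>
      \<le> \<bar>implicit_op \<alpha> \<kappa> \<nu> V i\<bar> + (\<kappa> * (2 * S) + \<nu> * (2 * S))"
    by linarith
  then show ?thesis
    using True by (simp add: abs_mult algebra_simps)
next
  case False
  \<comment> \<open>A negative diagonal weight makes the left side nonpositive, so it is enough that
    the right side is nonnegative; the sign of \<open>S\<close> is read off from any one
    neighbour.\<close>
  have "S \<ge> 0" using assms(3)[of "i + 1"] by auto
  then have "0 \<le> \<bar>implicit_op \<alpha> \<kappa> \<nu> V i\<bar> + (2 * \<kappa> + 2 * \<nu>) * S"
    using assms by auto
  moreover have "(\<alpha> + 2 * \<kappa> + 2 * \<nu>) * \<bar>V i\<bar> \<le> 0"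
    using False by (intro mult_nonpos_nonneg) auto
  ultimately show ?thesis by linarith
qed

text \<open>Discrete maximum principle. The supremum over infinitely many cells need not be
  attained, so the step estimate is taken in every cell with \<open>S\<close> the supremum itself;
  passing to the supremum leaves \<open>\<alpha> * S \<le> G\<close>. Boundedness of
  \<open>V\<close> makes \<open>S\<close> finite.\<close>

lemma implicit_op_sup_bound:
  assumes "\<alpha> > 0" "\<kappa> \<ge> 0" "\<nu> \<ge> 0" and "bounded (range V)"
    and G: "\<And>i. \<bar>implicit_op \<alpha> \<kappa> \<nu> V i\<bar> \<le> G"
  shows "\<bar>V i\<bar> \<le> G / \<alpha>"
proof -
  define S where "S = (SUP j. \<bar>V j\<bar>)"
  have bdd: "bdd_above (range (\<lambda>j. \<bar>V j\<bar>))"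
    using assms(4) by (auto simp: bounded_iff bdd_above_def)
  have le_S: "\<bar>V j\<bar> \<le> S" for j
    unfolding S_def by (rule cSUP_upper[OF _ bdd]) simp
  have pos: "\<alpha> + 2 * \<kappa> + 2 * \<nu> > 0" using assms by linarith
  have "\<bar>V j\<bar> \<le> (G + (2 * \<kappa> + 2 * \<nu>) * S) / (\<alpha> + 2 * \<kappa> + 2 * \<nu>)" for j
    using implicit_op_step[OF assms(2,3), of j V S \<alpha>] le_S G[of j] pos
    by (simp add: pos_le_divide_eq mult.commute)
  then have "S \<le> (G + (2 * \<kappa> + 2 * \<nu>) * S) / (\<alpha> + 2 * \<kappa> + 2 * \<nu>)"
    unfolding S_def by (intro cSUP_least) auto
  then have "S \<le> G / \<alpha>"
    using pos assms(1) by (simp add: field_simps)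
  then show ?thesis using le_S[of i] by linarith
qed

text \<open>
  Each application of \<open>implicit_op_step\<close> improves the asymptotic bound by the factor \<open>q < 1\<close>, at the
  price of looking two cells further. Only pointwise convergence of the right-hand side is needed.
\<close>

lemma implicit_op_tendsto_zero:
  assumes "\<alpha> > 0" "\<kappa> \<ge> 0" "\<nu> \<ge> 0"
    and bound: "\<And>i. \<forall>\<^sub>F e in F. \<bar>V e i\<bar> \<le> B"
    and op: "\<And>i. ((\<lambda>e. implicit_op \<alpha> \<kappa> \<nu> (V e) i) \<longlongrightarrow> 0) F"
  shows "((\<lambda>e. V e i) \<longlongrightarrow> 0) F"
proof -
  define m where "m = \<alpha> + 2 * \<kappa> + 2 * \<nu>"
  define q where "q = (2 * \<kappa> + 2 * \<nu>) / m"
  have m: "m > 0" and q: "0 \<le> q" "q < 1"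
    using assms(1-3) by (auto simp: m_def q_def)
  \<comment> \<open>The induction is general in the cell and in the slack \<open>\<eta>\<close>:
    half of the slack goes to the four neighbours, the other half to the operator term, which is
    eventually below \<open>m * (\<eta> / 2)\<close>.\<close>
  have small: "\<forall>\<^sub>F e in F. \<bar>V e i\<bar> < q ^ k * B + \<eta>" if "\<eta> > 0" for k i \<eta>
    using that
  proof (induction k arbitrary: i \<eta>)
    case 0
    show ?case
      using bound[of i] by eventually_elim (use 0 in auto)
  next
    case (Suc k)
    have nb: "\<forall>\<^sub>F e in F. \<forall>j\<in>{i - 2, i - 1, i + 1, i + 2}. \<bar>V e j\<bar> < q ^ k * B + \<eta> / 2"
      by (intro eventually_ball_finite ballI Suc.IH) (use Suc.prems in auto)
    have "m * (\<eta> / 2) > 0" using m Suc.prems by simp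
    then have "\<forall>\<^sub>F e in F. \<bar>implicit_op \<alpha> \<kappa> \<nu> (V e) i\<bar> < m * (\<eta> / 2)"
      using op[of i] by (simp only: tendsto_iff dist_real_def diff_0_right)
    with nb show ?case
    proof eventually_elim
      case (elim e)
      have "m * \<bar>V e i\<bar> \<le> \<bar>implicit_op \<alpha> \<kappa> \<nu> (V e) i\<bar> + (2 * \<kappa> + 2 * \<nu>) * (q ^ k * B + \<eta> / 2)"
        unfolding m_def using elim(1) by (intro implicit_op_step assms) (auto intro: less_imp_le)
      also have "\<dots> < m * (\<eta> / 2) + (2 * \<kappa> + 2 * \<nu>) * (q ^ k * B + \<eta> / 2)"
        using elim(2) by simp
      also have "\<dots> = m * (\<eta> / 2 + q * (q ^ k * B + \<eta> / 2))"
        using m by (simp add: q_def field_simps)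
      finally have "\<bar>V e i\<bar> < \<eta> / 2 + q * (q ^ k * B + \<eta> / 2)"
        using m by simp
      moreover have "q * (\<eta> / 2) \<le> \<eta> / 2"
        using q Suc.prems by (intro mult_left_le_one_le) auto
      ultimately show ?case by (simp add: algebra_simps)
    qed
  qed
  show ?thesis
    unfolding tendsto_iff
  proof (intro allI impI)
    fix \<eta> :: real
    assume "\<eta> > 0"
    have "(\<lambda>k. q ^ k * B) \<longlonglongrightarrow> 0 * B"
      using q by (intro tendsto_mult LIMSEQ_realpow_zero tendsto_const) auto
    then have "\<forall>\<^sub>F k in sequentially. q ^ k * B < \<eta> / 2"
      using \<open>\<eta> > 0\<close> by (intro order_tendstoD(2)[where y = "0 * B"]) auto
    then obtain k where "q ^ k * B < \<eta> / 2"
      by (auto simp: eventually_sequentially)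
    moreover have "\<forall>\<^sub>F e in F. \<bar>V e i\<bar> < q ^ k * B + \<eta> / 2"
      using small[of "\<eta> / 2" i k] \<open>\<eta> > 0\<close> by simp
    ultimately show "\<forall>\<^sub>F e in F. dist (V e i) 0 < \<eta>"
      by (auto elim!: eventually_mono simp: dist_real_def)
  qed
qed

text \<open>No candidate for the limit is at hand, so a Cauchy argument is used. By linearity the
  difference of the values at two parameters solves the equation with a right-hand side tending to
  \<open>f - f = 0\<close> along the product filter, hence tends to zero itself; completeness of the
  reals does the rest.\<close>

lemma implicit_op_convergent:
  fixes V :: "'a \<Rightarrow> int \<Rightarrow> real"
  assumes "\<alpha> > 0" "\<kappa> \<ge> 0" "\<nu> \<ge> 0" and "F \<noteq> bot"
    and bound: "\<And>i. \<forall>\<^sub>F e in F. \<bar>V e i\<bar> \<le> B"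
    and op: "\<And>i. \<exists>f. ((\<lambda>e. implicit_op \<alpha> \<kappa> \<nu> (V e) i) \<longlongrightarrow> f) F"
  shows "\<exists>v. ((\<lambda>e. V e i) \<longlongrightarrow> v) F"
proof -
  define W where "W = (\<lambda>p j. V (fst p) j - V (snd p) j)"
  have W: "((\<lambda>p. W p i) \<longlongrightarrow> 0) (F \<times>\<^sub>F F)"
  proof (rule implicit_op_tendsto_zero[OF assms(1-3)])
    fix j
    have "\<forall>\<^sub>F p in F \<times>\<^sub>F F. \<bar>V (fst p) j\<bar> \<le> B \<and> \<bar>V (snd p) j\<bar> \<le> B"
      by (intro eventually_conj eventually_compose_filterlim[OF bound filterlim_fst]
            eventually_compose_filterlim[OF bound filterlim_snd])
    then show "\<forall>\<^sub>F p in F \<times>\<^sub>F F. \<bar>W p j\<bar> \<le> 2 * B"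
      by eventually_elim (auto simp: W_def)
    obtain f where f: "((\<lambda>e. implicit_op \<alpha> \<kappa> \<nu> (V e) j) \<longlongrightarrow> f) F"
      using op by blast
    have "((\<lambda>p. implicit_op \<alpha> \<kappa> \<nu> (V (fst p)) j - implicit_op \<alpha> \<kappa> \<nu> (V (snd p)) j) \<longlongrightarrow> f - f)
            (F \<times>\<^sub>F F)"
      by (intro tendsto_diff filterlim_compose[OF f filterlim_fst] filterlim_compose[OF f filterlim_snd])
    also have "(\<lambda>p. implicit_op \<alpha> \<kappa> \<nu> (V (fst p)) j - implicit_op \<alpha> \<kappa> \<nu> (V (snd p)) j)
        = (\<lambda>p. implicit_op \<alpha> \<kappa> \<nu> (W p) j)"
      by (auto simp: implicit_op_def W_def algebra_simps)
    finally show "((\<lambda>p. implicit_op \<alpha> \<kappa> \<nu> (W p) j) \<longlongrightarrow> 0) (F \<times>\<^sub>F F)"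
      by simp
  qed
  have "cauchy_filter (filtermap (\<lambda>e. V e i) F)"
    unfolding cauchy_filter_metric_filtermap
  proof (intro allI impI)
    fix e :: real
    assume "e > 0"
    then have "\<forall>\<^sub>F p in F \<times>\<^sub>F F. \<bar>W p i\<bar> < e"
      using W by (auto simp: tendsto_iff dist_real_def)
    then obtain P where "eventually P F" "\<And>x y. P x \<Longrightarrow> P y \<Longrightarrow> \<bar>W (x, y) i\<bar> < e"
      by (auto simp: eventually_prod_same)
    then show "\<exists>P. eventually P F \<and> (\<forall>x y. P x \<and> P y \<longrightarrow> dist (V x i) (V y i) < e)"
      by (auto simp: W_def dist_real_def)
  qed
  moreover have "complete (UNIV :: real set)" by (rule complete_UNIV)
  ultimately have "\<exists>v\<in>UNIV. filtermap (\<lambda>e. V e i) F \<le> nhds v"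
    using assms(4) unfolding complete_uniform by (simp add: filtermap_bot_iff)
  then show ?thesis by (auto simp: filterlim_def)
qed

subsection \<open>Consistency with the diffusion equation\<close>

text \<open>The second difference is the increment over \<open>[x, x + h]\<close> of the function
  sending \<open>y\<close> to \<open>\<phi> y - \<phi> (y - h)\<close>. The mean value theorem for
  this function gives a point \<open>z\<close>, and a second application, to \<open>\<phi>1\<close>
  on \<open>[z - h, z]\<close>, gives \<open>\<xi>\<close>.\<close>

lemma second_difference_mvt:
  fixes \<phi> :: "real \<Rightarrow> real"
  assumes h: "h > 0"
    and d1: "\<And>y. \<bar>y - x\<bar> \<le> h \<Longrightarrow> (\<phi> has_real_derivative \<phi>1 y) (at y)"
    and d2: "\<And>y. \<bar>y - x\<bar> \<le> h \<Longrightarrow> (\<phi>1 has_real_derivative \<phi>2 y) (at y)"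
  obtains \<xi> where "\<bar>\<xi> - x\<bar> < h" and "\<phi> (x + h) - 2 * \<phi> x + \<phi> (x - h) = h\<^sup>2 * \<phi>2 \<xi>"
proof -
  have "\<exists>z>x. z < x + h \<and> (\<phi> (x + h) - \<phi> (x + h - h)) - (\<phi> x - \<phi> (x - h))
          = (x + h - x) * (\<phi>1 z - \<phi>1 (z - h))"
  proof (rule MVT2)
    show "x < x + h" using h by simp
    fix y
    assume y: "x \<le> y" "y \<le> x + h"
    have "((\<lambda>y. \<phi> (y - h)) has_real_derivative \<phi>1 (y - h) * 1) (at y)"
      by (rule DERIV_chain'[where f = "\<lambda>y. y - h" and g = \<phi>])
        (use y in \<open>auto intro!: derivative_eq_intros d1\<close>)
    then show "((\<lambda>y. \<phi> y - \<phi> (y - h)) has_real_derivative \<phi>1 y - \<phi>1 (y - h)) (at y)"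
      using y by (auto intro!: DERIV_diff d1)
  qed
  then obtain z where z: "x < z" "z < x + h"
    and e1: "\<phi> (x + h) - 2 * \<phi> x + \<phi> (x - h) = h * (\<phi>1 z - \<phi>1 (z - h))"
    by (auto simp: algebra_simps)
  have "\<exists>\<xi>>z - h. \<xi> < z \<and> \<phi>1 z - \<phi>1 (z - h) = (z - (z - h)) * \<phi>2 \<xi>"
    using h z by (intro MVT2 d2) auto
  then obtain \<xi> where "z - h < \<xi>" "\<xi> < z" "\<phi>1 z - \<phi>1 (z - h) = h * \<phi>2 \<xi>"
    by auto
  with z e1 show ?thesis
    by (intro that[of \<xi>]) (auto simp: power2_eq_square)
qed

text \<open>The mean value form turns the quotient into the second space derivative at time
  \<open>t + k\<close> and a point within \<open>h\<close> of \<open>x\<close>. Joint continuity of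
  that derivative then allows \<open>h\<close> and \<open>k\<close> to vanish independently.\<close>

lemma second_difference_tendsto:
  assumes S: "open S" "(t, x) \<in> S"
    and d1: "\<And>s y. (s, y) \<in> S \<Longrightarrow> u s differentiable (at y)"
    and d2: "\<And>s y. (s, y) \<in> S \<Longrightarrow> deriv (u s) differentiable (at y)"
    and cont: "continuous_on S (\<lambda>(s, y). deriv (deriv (u s)) y)"
  shows "((\<lambda>(h, k). (u (t + k) (x + h) - 2 * u (t + k) x + u (t + k) (x - h)) / h\<^sup>2)
            \<longlongrightarrow> deriv (deriv (u t)) x) (at_right (0::real) \<times>\<^sub>F at_right (0::real))"
  unfolding tendsto_iff
proof (intro allI impI)
  fix e :: real
  assume "e > 0"
  have "isCont (\<lambda>(s, y). deriv (deriv (u s)) y) (t, x)"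
    using cont S by (simp add: continuous_on_eq_continuous_at)
  then have "\<forall>\<^sub>F p in nhds (t, x). dist (case p of (s, y) \<Rightarrow> deriv (deriv (u s)) y) (deriv (deriv (u t)) x) < e"
    using \<open>e > 0\<close> unfolding isCont_def
    by (subst (asm) tendsto_at_iff_tendsto_nhds) (auto simp: tendsto_iff)
  moreover have "\<forall>\<^sub>F p in nhds (t, x). p \<in> S"
    using S by (simp add: eventually_nhds_in_open)
  ultimately have "\<forall>\<^sub>F p in nhds (t, x). p \<in> S \<and>
      dist (case p of (s, y) \<Rightarrow> deriv (deriv (u s)) y) (deriv (deriv (u t)) x) < e"
    by eventually_elim auto
  \<comment> \<open>The neighbourhood is shrunk to a product box, so that the restrictions on
    \<open>k\<close> and on \<open>h\<close> are separate, as the product filter demands.\<close>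
  then obtain P Q where P: "eventually P (nhds t)" and Q: "eventually Q (nhds x)"
    and PQ: "\<And>s y. P s \<Longrightarrow> Q y \<Longrightarrow> (s, y) \<in> S \<and> dist (deriv (deriv (u s)) y) (deriv (deriv (u t)) x) < e"
    unfolding nhds_prod eventually_prod_filter by auto
  obtain a where a: "a > 0" "\<And>s. dist s t < a \<Longrightarrow> P s"
    using P by (auto simp: eventually_nhds_metric)
  obtain b where b: "b > 0" "\<And>y. dist y x < b \<Longrightarrow> Q y"
    using Q by (auto simp: eventually_nhds_metric)
  have main: "dist ((u (t + k) (x + h) - 2 * u (t + k) x + u (t + k) (x - h)) / h\<^sup>2)
          (deriv (deriv (u t)) x) < e" if hk: "0 < h" "h < b" "0 < k" "k < a" for h k
  proof -
    \<comment> \<open>The whole segment of radius \<open>h\<close> at time \<open>t + k\<close> has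
      to lie in \<open>S\<close>, since the mean value form differentiates along it.\<close>
    have in_S: "(t + k, y) \<in> S" if "\<bar>y - x\<bar> \<le> h" for y
      using PQ a(2)[of "t + k"] b(2)[of y] hk that by (auto simp: dist_real_def)
    obtain \<xi> where \<xi>: "\<bar>\<xi> - x\<bar> < h"
      "u (t + k) (x + h) - 2 * u (t + k) x + u (t + k) (x - h) = h\<^sup>2 * deriv (deriv (u (t + k))) \<xi>"
      by (rule second_difference_mvt[OF hk(1), of x "u (t + k)" "deriv (u (t + k))" "deriv (deriv (u (t + k)))"])
        (use in_S d1 d2 in \<open>auto simp: DERIV_deriv_iff_real_differentiable\<close>)
    then show ?thesis
      using PQ[of "t + k" \<xi>] a(2)[of "t + k"] b(2)[of \<xi>] hk by (auto simp: dist_real_def)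
  qed
  have "\<forall>\<^sub>F h in at_right 0. 0 < h \<and> h < b" "\<forall>\<^sub>F k in at_right 0. 0 < k \<and> k < a"
    using a(1) b(1) by (auto simp: eventually_at_right_field)
  then show "\<forall>\<^sub>F p in at_right 0 \<times>\<^sub>F at_right 0.
      dist (case p of (h, k) \<Rightarrow> (u (t + k) (x + h) - 2 * u (t + k) x + u (t + k) (x - h)) / h\<^sup>2)
        (deriv (deriv (u t)) x) < e"
    unfolding eventually_prod_filter using main
    by (intro exI[of _ "\<lambda>h. 0 < h \<and> h < b"] exI[of _ "\<lambda>k. 0 < k \<and> k < a"]) auto
qed

text \<open>The residual splits into a time quotient, a second-difference quotient of spacing
  \<open>2 * \<Delta>x\<close>, the Lax-Friedrichs term and absorption. The spatial terms and
  absorption sit at the new time, so their limits are taken jointly in both mesh sizes.\<close>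

lemma five_point_consistent:
  "consistent_with (five_point_residual c \<sigma>\<^sub>s \<sigma>\<^sub>a) (diffusion_residual c \<sigma>\<^sub>s \<sigma>\<^sub>a)"
  unfolding consistent_with_def
proof (intro allI impI, elim conjE)
  fix S :: "(real \<times> real) set" and u t x
  assume S: "open S" and C: "C12_on S u" and tx: "(t, x) \<in> S"
  let ?F = "at_right (0::real) \<times>\<^sub>F at_right (0::real)"
  let ?\<delta> = "\<lambda>h k. u (t + k) (x + h) - 2 * u (t + k) x + u (t + k) (x - h)"
  let ?uxx = "deriv (deriv (u t)) x"
  have d1: "u s differentiable (at y)" and d2: "deriv (u s) differentiable (at y)"
    and d3: "(\<lambda>r. u r y) differentiable (at s)" if "(s, y) \<in> S" for s y
    using C that by (auto simp: C12_on_def)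
  have sd: "((\<lambda>(h, k). ?\<delta> h k / h\<^sup>2) \<longlongrightarrow> ?uxx) ?F"
    using C by (intro second_difference_tendsto[OF S tx] d1 d2) (auto simp: C12_on_def)
  have fst0: "((\<lambda>p. fst p) \<longlongrightarrow> 0) ?F" and snd0: "((\<lambda>p. snd p) \<longlongrightarrow> 0) ?F"
    by (rule filterlim_compose[OF tendsto_ident_at filterlim_fst],
        rule filterlim_compose[OF tendsto_ident_at filterlim_snd])
  have "((\<lambda>k. (u (t + k) x - u t x) / k) \<longlongrightarrow> deriv (\<lambda>s. u s x) t) (at 0)"
    using d3[OF tx] by (simp flip: DERIV_deriv_iff_real_differentiable add: DERIV_def)
  then have "((\<lambda>k. (u (t + k) x - u t x) / k) \<longlongrightarrow> deriv (\<lambda>s. u s x) t) (at_right 0)"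
    by (rule tendsto_mono[OF at_le, rotated]) simp
  then have time: "((\<lambda>p. (u (t + snd p) x - u t x) / snd p) \<longlongrightarrow> deriv (\<lambda>s. u s x) t) ?F"
    by (rule filterlim_compose[OF _ filterlim_snd])
  have "isCont (\<lambda>s. u s x) t"
    using d3[OF tx] by (rule differentiable_imp_continuous_within)
  moreover have "((\<lambda>p. t + snd p) \<longlongrightarrow> t) ?F"
    using tendsto_add[OF tendsto_const snd0] by simp
  ultimately have val: "((\<lambda>p. u (t + snd p) x) \<longlongrightarrow> u t x) ?F"
    by (rule isCont_tendsto_compose)
  \<comment> \<open>The diffusion term has spacing \<open>2 * \<Delta>x\<close>; its limit is that
    of \<open>sd\<close> composed with doubling the first component.\<close>
  have "filterlim (\<lambda>h::real. 2 * h) (at_right 0) (at_right 0)"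
    unfolding filterlim_at by (auto intro!: tendsto_eq_intros simp: eventually_at_filter)
  then have "filterlim (\<lambda>p. (2 * fst p, snd p)) ?F ?F"
    by (intro filterlim_Pair filterlim_snd filterlim_compose[OF _ filterlim_fst])
  from filterlim_compose[OF sd this]
  have sd2: "((\<lambda>p. ?\<delta> (2 * fst p) (snd p) / (2 * fst p)\<^sup>2) \<longlongrightarrow> ?uxx) ?F"
    by simp
  \<comment> \<open>The Lax-Friedrichs term is written as \<open>\<Delta>x / 2\<close> times a
    convergent second-difference quotient, so it disappears in the limit.\<close>
  have "((\<lambda>p. 1 / c * ((u (t + snd p) x - u t x) / snd p)
           - 1 / (3 * \<sigma>\<^sub>s) * (?\<delta> (2 * fst p) (snd p) / (2 * fst p)\<^sup>2)
           - fst p / 2 * (?\<delta> (fst p) (snd p) / (fst p)\<^sup>2)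
           + \<sigma>\<^sub>a * u (t + snd p) x)
        \<longlongrightarrow> 1 / c * deriv (\<lambda>s. u s x) t - 1 / (3 * \<sigma>\<^sub>s) * ?uxx - 0 / 2 * ?uxx + \<sigma>\<^sub>a * u t x) ?F"
    using sd by (intro tendsto_intros time val sd2 fst0) (auto simp: case_prod_unfold)
  moreover have "(\<lambda>p. 1 / c * ((u (t + snd p) x - u t x) / snd p)
           - 1 / (3 * \<sigma>\<^sub>s) * (?\<delta> (2 * fst p) (snd p) / (2 * fst p)\<^sup>2)
           - fst p / 2 * (?\<delta> (fst p) (snd p) / (fst p)\<^sup>2)
           + \<sigma>\<^sub>a * u (t + snd p) x)
      = (\<lambda>(\<Delta>x, \<Delta>t). five_point_residual c \<sigma>\<^sub>s \<sigma>\<^sub>a \<Delta>x \<Delta>t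
           (\<lambda>n i. u (t + real n * \<Delta>t) (x + real_of_int i * \<Delta>x)) 0 0)"
    by (rule ext) (auto simp: five_point_residual_def v_max_def power2_eq_square)
  moreover have "deriv (\<lambda>y. 1 / (3 * \<sigma>\<^sub>s) * deriv (u t) y) x = 1 / (3 * \<sigma>\<^sub>s) * ?uxx"
    using d2[OF tx] by (intro DERIV_imp_deriv DERIV_cmult) (simp add: DERIV_deriv_iff_real_differentiable)
  ultimately show "((\<lambda>(\<Delta>x, \<Delta>t). five_point_residual c \<sigma>\<^sub>s \<sigma>\<^sub>a \<Delta>x \<Delta>t
           (\<lambda>n i. u (t + real n * \<Delta>t) (x + real_of_int i * \<Delta>x)) 0 0)
         \<longlongrightarrow> diffusion_residual c \<sigma>\<^sub>s \<sigma>\<^sub>a u t x) ?F"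
    by (simp add: diffusion_residual_def)
qed

subsection \<open>Estimates for the scheme\<close>

lemma central_diff_bound:
  assumes "d > 0" "\<bar>f (i + 1)\<bar> \<le> K" "\<bar>f (i - 1)\<bar> \<le> K"
  shows "\<bar>central_diff d f i\<bar> \<le> K / d"
proof -
  have "\<bar>f (i + 1) - f (i - 1)\<bar> \<le> 2 * K" using assms by linarith
  then show ?thesis using assms(1) by (simp add: central_diff_def field_simps)
qed

lemma lax_friedrichs_bound:
  assumes "d > 0" "\<bar>f (i + 1)\<bar> \<le> K" "\<bar>f i\<bar> \<le> K" "\<bar>f (i - 1)\<bar> \<le> K"
  shows "\<bar>lax_friedrichs d f i\<bar> \<le> 2 * K / d"
proof -
  have "\<bar>f (i + 1) - 2 * f i + f (i - 1)\<bar> \<le> 4 * K" using assms by linarith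
  then show ?thesis using assms(1) by (simp add: lax_friedrichs_def v_max_def abs_mult field_simps)
qed

lemma central_diff_linear:
  "central_diff d (\<lambda>j. p * f j + q * g j + r * k j) i
    = p * central_diff d f i + q * central_diff d g i + r * central_diff d k i"
  by (simp add: central_diff_def diff_divide_distrib add_divide_distrib algebra_simps)

lemma pn_a_bound: "\<bar>pn_a k\<bar> \<le> 1"
  by (simp add: pn_a_def)

lemma pn_b_bound: "\<bar>pn_b (k + 1)\<bar> \<le> 1"
  by (simp add: pn_b_def)

lemma tendsto_zero_at_right_linear:
  fixes f :: "real \<Rightarrow> real"
  assumes "\<forall>\<^sub>F \<epsilon> in at_right 0. \<bar>f \<epsilon>\<bar> \<le> \<epsilon> * K"
  shows "(f \<longlongrightarrow> 0) (at_right 0)"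
proof (rule Lim_null_comparison)
  show "\<forall>\<^sub>F \<epsilon> in at_right 0. norm (f \<epsilon>) \<le> \<epsilon> * K" using assms by simp
  show "((\<lambda>\<epsilon>. \<epsilon> * K) \<longlongrightarrow> 0) (at_right 0)"
    using tendsto_mult_left_zero[OF tendsto_ident_at] .
qed

lemma eventually_at_right_unit: "\<forall>\<^sub>F \<epsilon> in at_right (0::real). 0 < \<epsilon> \<and> \<epsilon> \<le> 1"
  unfolding eventually_at_right_field by (rule exI[of _ 1]) auto

text \<open>The maximum of finitely many constants serves all indices, which is why \<open>P\<close>
  must be monotone in the constant. \<open>P\<close> is left abstract to cover stencil values as
  well as whole families of moments.\<close>

lemma eventually_common_bound:
  fixes P :: "real \<Rightarrow> 'i \<Rightarrow> 'a \<Rightarrow> bool"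
  assumes "finite J"
    and "\<And>j. j \<in> J \<Longrightarrow> \<exists>K. eventually (P K j) F"
    and mono: "\<And>K K' j e. P K j e \<Longrightarrow> K \<le> K' \<Longrightarrow> P K' j e"
  shows "\<exists>K. \<forall>\<^sub>F e in F. \<forall>j\<in>J. P K j e"
  using assms(1,2)
proof (induction J)
  case (insert j J)
  then obtain K1 K2 where "eventually (P K1 j) F" "\<forall>\<^sub>F e in F. \<forall>j\<in>J. P K2 j e"
    by (metis insert_iff)
  then have "\<forall>\<^sub>F e in F. \<forall>i\<in>insert j J. P (max K1 K2) i e"
    by eventually_elim (auto intro: mono)
  then show ?case ..
qed simp

text \<open>Solving the second equation for \<open>w\<close> and inserting it into the first gives a
  five-point equation for \<open>u\<close>, perturbed by \<open>\<epsilon>\<close> times a term in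
  \<open>w\<close>. The maximum principle bounds \<open>u\<close> by the data and
  \<open>\<epsilon> * sup |w|\<close>; put back into the second equation, this bounds
  \<open>w\<close> by itself with a factor proportional to \<open>\<epsilon>\<close>. The threshold
  depends on the coefficients only, not on the data bounds \<open>G\<close> and
  \<open>H\<close>.\<close>

lemma coupled_stability:
  assumes "\<alpha> > 0" "\<sigma> > 0" "d > 0"
  obtains \<epsilon>\<^sub>0 K where "\<epsilon>\<^sub>0 > 0"
    and "\<And>\<epsilon> \<beta> u w f h i. \<lbrakk>0 < \<epsilon>; \<epsilon> < \<epsilon>\<^sub>0; \<sigma> \<le> \<beta>; bounded (range u); bounded (range w);
           \<And>i. \<bar>f i\<bar> \<le> G; \<And>i. \<bar>h i\<bar> \<le> H;
           \<And>i. \<alpha> * u i + central_diff d w i - lax_friedrichs d u i = f i;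
           \<And>i. \<beta> * w i + 1 / 3 * central_diff d u i - \<epsilon> * lax_friedrichs d w i = h i\<rbrakk>
         \<Longrightarrow> \<bar>u i\<bar> \<le> K \<and> \<bar>w i\<bar> \<le> K"
proof -
  \<comment> \<open>The constants come from the loop inequality
    \<open>Y \<le> P + \<epsilon> * Q * Y\<close> for \<open>Y = sup |w|\<close>. For
    \<open>\<epsilon> < 1 / (2 * Q)\<close> it yields \<open>Y \<le> 2 * P\<close>; \<open>X\<close>
    is the resulting bound for \<open>u\<close>.\<close>
  define Q where "Q = (2 / d / d / \<sigma> / \<alpha> / d / 3 + 2 / d) / \<sigma>"
  define P where "P = (H + (G + H / d / \<sigma>) / \<alpha> / d / 3) / \<sigma>"
  define X where "X = (G + (H / d + 1 / (2 * Q) * (2 * (2 * P) / d / d)) / \<sigma>) / \<alpha>"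
  have Q: "Q > 0" using assms by (simp add: Q_def add_pos_pos)
  show thesis
  proof (rule that[of "1 / (2 * Q)" "max X (2 * P)"])
    show "1 / (2 * Q) > 0" using Q by simp
    fix \<epsilon> \<beta> :: real and u w f h :: "int \<Rightarrow> real" and i
    assume \<epsilon>: "0 < \<epsilon>" "\<epsilon> < 1 / (2 * Q)" and \<beta>: "\<sigma> \<le> \<beta>"
      and bdd_u: "bounded (range u)" and bdd_w: "bounded (range w)"
      and f: "\<And>i. \<bar>f i\<bar> \<le> G" and h: "\<And>i. \<bar>h i\<bar> \<le> H"
      and eq_u: "\<And>i. \<alpha> * u i + central_diff d w i - lax_friedrichs d u i = f i"
      and eq_w: "\<And>i. \<beta> * w i + 1 / 3 * central_diff d u i - \<epsilon> * lax_friedrichs d w i = h i"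
    \<comment> \<open>Boundedness of \<open>w\<close> only makes \<open>Y\<close> finite here; a
      bound in terms of the data is obtained at the end by absorption.\<close>
    define Y where "Y = (SUP j. \<bar>w j\<bar>)"
    have bdd: "bdd_above (range (\<lambda>j. \<bar>w j\<bar>))"
      using bdd_w by (auto simp: bounded_iff bdd_above_def)
    have wY: "\<bar>w j\<bar> \<le> Y" for j
      unfolding Y_def by (rule cSUP_upper[OF _ bdd]) simp
    have Y0: "Y \<ge> 0" using wY[of 0] by linarith
    have H0: "H \<ge> 0" using h[of 0] by linarith
    have \<beta>0: "\<beta> > 0" using \<beta> assms(2) by linarith
    have w_eq: "w = (\<lambda>j. 1 / \<beta> * h j + (- 1 / (3 * \<beta>)) * central_diff d u j
        + \<epsilon> / \<beta> * lax_friedrichs d w j)"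
    proof
      fix j
      show "w j = 1 / \<beta> * h j + (- 1 / (3 * \<beta>)) * central_diff d u j + \<epsilon> / \<beta> * lax_friedrichs d w j"
        using eq_w[of j] \<beta>0 by (simp add: field_simps)
    qed
    have Dw: "central_diff d w j = 1 / \<beta> * central_diff d h j
        + (- 1 / (3 * \<beta>)) * central_diff d (central_diff d u) j
        + \<epsilon> / \<beta> * central_diff d (lax_friedrichs d w) j" for j
      using w_eq central_diff_linear by metis
    \<comment> \<open>Two central differences reach two cells to either side with effective spacing
      \<open>2 * d\<close>, which is the \<open>\<kappa>\<close> part of the operator; the
      Lax-Friedrichs term is the \<open>\<nu>\<close> part.\<close>
    have op: "implicit_op \<alpha> (1 / (3 * \<beta> * (2 * d)\<^sup>2)) (1 / (2 * d)) u j
        = f j - (central_diff d h j + \<epsilon> * central_diff d (lax_friedrichs d w) j) / \<beta>" for j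
    proof -
      have "implicit_op \<alpha> (1 / (3 * \<beta> * (2 * d)\<^sup>2)) (1 / (2 * d)) u j
          = \<alpha> * u j - central_diff d (central_diff d u) j / (3 * \<beta>) - lax_friedrichs d u j"
        by (simp add: implicit_op_def central_diff_def lax_friedrichs_def v_max_def power2_eq_square
            diff_divide_distrib add_divide_distrib algebra_simps)
      then show ?thesis
        using eq_u[of j] Dw[of j] by (simp add: add_divide_distrib diff_divide_distrib)
    qed
    have op_le: "\<bar>implicit_op \<alpha> (1 / (3 * \<beta> * (2 * d)\<^sup>2)) (1 / (2 * d)) u j\<bar>
        \<le> G + (H / d + \<epsilon> * (2 * Y / d / d)) / \<sigma>" for j
    proof -
      have "\<bar>central_diff d h j\<bar> \<le> H / d"
        using assms(3) h by (intro central_diff_bound) auto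
      moreover have "\<bar>central_diff d (lax_friedrichs d w) j\<bar> \<le> 2 * Y / d / d"
        using assms(3) wY by (intro central_diff_bound lax_friedrichs_bound) auto
      then have "\<bar>\<epsilon> * central_diff d (lax_friedrichs d w) j\<bar> \<le> \<epsilon> * (2 * Y / d / d)"
        using \<epsilon> unfolding abs_mult by (intro mult_mono) auto
      ultimately have "\<bar>central_diff d h j + \<epsilon> * central_diff d (lax_friedrichs d w) j\<bar>
          \<le> H / d + \<epsilon> * (2 * Y / d / d)"
        by linarith
      then have "\<bar>(central_diff d h j + \<epsilon> * central_diff d (lax_friedrichs d w) j) / \<beta>\<bar>
          \<le> (H / d + \<epsilon> * (2 * Y / d / d)) / \<sigma>"
        using \<beta> \<beta>0 assms(2) unfolding abs_divide by (intro frac_le) auto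
      then show ?thesis using op[of j] f[of j] by linarith
    qed
    have u_le: "\<bar>u j\<bar> \<le> (G + (H / d + \<epsilon> * (2 * Y / d / d)) / \<sigma>) / \<alpha>" (is "_ \<le> ?X") for j
      by (rule implicit_op_sup_bound[OF _ _ _ bdd_u op_le]) (use assms \<beta>0 in auto)
    have w_le: "\<bar>w j\<bar> \<le> (H + 1 / 3 * (?X / d) + \<epsilon> * (2 * Y / d)) / \<sigma>" for j
    proof -
      have "\<bar>central_diff d u j\<bar> \<le> ?X / d"
        using assms(3) u_le by (intro central_diff_bound) auto
      moreover have "\<bar>lax_friedrichs d w j\<bar> \<le> 2 * Y / d"
        using assms(3) wY by (intro lax_friedrichs_bound) auto
      then have "\<bar>\<epsilon> * lax_friedrichs d w j\<bar> \<le> \<epsilon> * (2 * Y / d)"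
        using \<epsilon> unfolding abs_mult by (intro mult_mono) auto
      moreover have triangle: "\<bar>a - 1 / 3 * b + m\<bar> \<le> A + 1 / 3 * B + N"
        if "\<bar>a\<bar> \<le> A" "\<bar>b\<bar> \<le> B" "\<bar>m\<bar> \<le> N" for a b m A B N :: real
        using that by linarith
      ultimately have "\<bar>h j - 1 / 3 * central_diff d u j + \<epsilon> * lax_friedrichs d w j\<bar>
          \<le> H + 1 / 3 * (?X / d) + \<epsilon> * (2 * Y / d)"
        using h[of j] triangle[of "h j" H "central_diff d u j" "?X / d"] by blast
      then have "\<bar>(h j - 1 / 3 * central_diff d u j + \<epsilon> * lax_friedrichs d w j) / \<beta>\<bar>
          \<le> (H + 1 / 3 * (?X / d) + \<epsilon> * (2 * Y / d)) / \<sigma>"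
        using \<beta> \<beta>0 assms(2) unfolding abs_divide by (intro frac_le) auto
      moreover have "w j = (h j - 1 / 3 * central_diff d u j + \<epsilon> * lax_friedrichs d w j) / \<beta>"
        using eq_w[of j] \<beta>0 by (simp add: field_simps)
      ultimately show ?thesis by (simp only:)
    qed
    have "Y \<le> (H + 1 / 3 * (?X / d) + \<epsilon> * (2 * Y / d)) / \<sigma>"
      unfolding Y_def[symmetric] using w_le by (subst Y_def, intro cSUP_least) auto
    also have "\<dots> = P + (\<epsilon> * Q) * Y"
      using assms by (simp add: P_def Q_def add_divide_distrib algebra_simps)
    also have "(\<epsilon> * Q) * Y \<le> 1 / 2 * Y"
      using \<epsilon> Q Y0 by (intro mult_right_mono) (auto simp: field_simps)
    finally have YP: "Y \<le> 2 * P" by simp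
    have "\<epsilon> * (2 * Y / d / d) \<le> 1 / (2 * Q) * (2 * (2 * P) / d / d)"
      using \<epsilon> Q Y0 YP assms(3) by (intro mult_mono divide_right_mono) auto
    then have "?X \<le> X"
      unfolding X_def using assms by (intro divide_right_mono add_left_mono) auto
    then show "\<bar>u i\<bar> \<le> max X (2 * P) \<and> \<bar>w i\<bar> \<le> max X (2 * P)"
      using u_le[of i] wY[of i] YP by linarith
  qed
qed

text \<open>The terms of the equation for the rescaled first moment that carry no power of
  \<open>\<epsilon>\<close>, that is, the error in the discrete Fick law with the second moment at
  the old level.\<close>

definition flux_defect ::
  "real \<Rightarrow> real \<Rightarrow> real \<Rightarrow> (nat \<Rightarrow> nat \<Rightarrow> int \<Rightarrow> real) \<Rightarrow> nat \<Rightarrow> int \<Rightarrow> real" where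
  "flux_defect \<sigma>\<^sub>s \<Delta>x \<epsilon> I n i = \<sigma>\<^sub>s * I1_hat \<epsilon> I (n + 1) i
     + pn_a 0 * central_diff \<Delta>x (I 0 (n + 1)) i + pn_b 2 * central_diff \<Delta>x (I 2 n) i"

section \<open>Estimates and identities for one time step at fixed \<open>\<epsilon>\<close>\<close>

locale imex_pn =
  fixes c \<sigma>\<^sub>s \<sigma>\<^sub>a \<Delta>x \<Delta>t :: real and M :: nat
  assumes c: "c > 0" and \<sigma>\<^sub>s: "\<sigma>\<^sub>s > 0" and \<sigma>\<^sub>a: "\<sigma>\<^sub>a \<ge> 0" and \<Delta>x: "\<Delta>x > 0" and \<Delta>t: "\<Delta>t > 0"
    and M: "M \<ge> 1"
begin

abbreviation "scheme \<equiv> imex_pn_scheme c \<sigma>\<^sub>s \<sigma>\<^sub>a \<Delta>x \<Delta>t M"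
abbreviation "residual \<equiv> five_point_residual c \<sigma>\<^sub>s \<sigma>\<^sub>a \<Delta>x \<Delta>t"

lemma scheme_closure: "scheme \<epsilon> C I \<Longrightarrow> l = M + 1 \<Longrightarrow> I l n i = 0"
  by (simp add: imex_pn_scheme_def)

text \<open>Apart from the relaxation, every term of the equation has a factor
  \<open>\<epsilon>\<close>, while the implicit coefficient of the new value is at least
  \<open>\<sigma>\<^sub>s\<close>. The lower neighbour enters at the new level, so bounds have to be
  gained in increasing order of \<open>l\<close>. The \<open>4 / \<Delta>x\<close> adds one unit for
  each central difference and two for the Lax-Friedrichs term.\<close>

lemma moment_bound:
  assumes "scheme \<epsilon> C I" "0 < \<epsilon>" "\<epsilon> \<le> 1" "i \<in> C" "l \<in> {2..M}"
    and bound: "\<And>j. j \<in> {i - 1..i + 1} \<Longrightarrow>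
      \<bar>I (l - 1) (n + 1) j\<bar> \<le> K \<and> \<bar>I l n j\<bar> \<le> K \<and> \<bar>I (l + 1) n j\<bar> \<le> K"
  shows "\<bar>I l (n + 1) i\<bar> \<le> \<epsilon> * (K * (1 / (c * \<Delta>t) + 4 / \<Delta>x) / \<sigma>\<^sub>s)"
proof -
  let ?\<tau> = "1 / (c * \<Delta>t)"
  let ?a = "pn_a (l - 1) * central_diff \<Delta>x (I (l - 1) (n + 1)) i"
  let ?b = "pn_b (l + 1) * central_diff \<Delta>x (I (l + 1) n) i"
  let ?L = "lax_friedrichs \<Delta>x (I l n) i"
  let ?\<beta> = "\<epsilon>\<^sup>2 * ?\<tau> + \<epsilon>\<^sup>2 * \<sigma>\<^sub>a + \<sigma>\<^sub>s"
  have \<tau>: "?\<tau> > 0" using c \<Delta>t by simp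
  have K: "K \<ge> 0" using bound[of i] by auto
  have "\<epsilon>\<^sup>2 / c * ((I l (n + 1) i - I l n i) / \<Delta>t) + \<epsilon> * ?a + \<epsilon> * ?b - \<epsilon> * ?L
      = - (\<epsilon>\<^sup>2 * \<sigma>\<^sub>a + \<sigma>\<^sub>s) * I l (n + 1) i"
    using assms(1,4,5) by (simp add: imex_pn_scheme_def mult.assoc)
  then have eq: "?\<beta> * I l (n + 1) i = \<epsilon> * (\<epsilon> * ?\<tau> * I l n i - ?a - ?b + ?L)"
    by (simp add: power2_eq_square algebra_simps diff_divide_distrib)
  have "\<bar>\<epsilon> * ?\<tau> * I l n i\<bar> \<le> 1 * ?\<tau> * K"
    using assms(2,3) \<tau> bound[of i] K unfolding abs_mult by (intro mult_mono) auto
  moreover have "\<bar>?a\<bar> \<le> 1 * (K / \<Delta>x)"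
    using bound[of "i + 1"] bound[of "i - 1"] \<Delta>x K
    unfolding abs_mult by (intro mult_mono pn_a_bound central_diff_bound) auto
  moreover have "\<bar>?b\<bar> \<le> 1 * (K / \<Delta>x)"
    using bound[of "i + 1"] bound[of "i - 1"] \<Delta>x K
    unfolding abs_mult by (intro mult_mono pn_b_bound central_diff_bound) auto
  moreover have "\<bar>?L\<bar> \<le> 2 * K / \<Delta>x"
    using bound[of "i + 1"] bound[of "i - 1"] bound[of i] \<Delta>x by (intro lax_friedrichs_bound) auto
  moreover have "K * (?\<tau> + 4 / \<Delta>x) = 1 * ?\<tau> * K + 1 * (K / \<Delta>x) + 1 * (K / \<Delta>x) + 2 * K / \<Delta>x"
    by (simp add: algebra_simps)
  moreover have "\<bar>y - a - b + m\<bar> \<le> Y + A + B + N"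
    if "\<bar>y\<bar> \<le> Y" "\<bar>a\<bar> \<le> A" "\<bar>b\<bar> \<le> B" "\<bar>m\<bar> \<le> N" for y a b m Y A B N :: real
    using that by linarith
  ultimately have "\<bar>\<epsilon> * ?\<tau> * I l n i - ?a - ?b + ?L\<bar> \<le> K * (?\<tau> + 4 / \<Delta>x)"
    by metis
  then have "\<bar>?\<beta> * I l (n + 1) i\<bar> \<le> \<epsilon> * (K * (?\<tau> + 4 / \<Delta>x))"
    unfolding eq abs_mult[of \<epsilon>] using assms(2) by (intro mult_mono) auto
  moreover have "\<sigma>\<^sub>s * \<bar>I l (n + 1) i\<bar> \<le> ?\<beta> * \<bar>I l (n + 1) i\<bar>"
    using \<tau> \<sigma>\<^sub>a by (intro mult_right_mono) auto
  moreover have "?\<beta> > 0" using \<tau> \<sigma>\<^sub>a \<sigma>\<^sub>s by (intro add_nonneg_pos) auto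
  ultimately have "\<sigma>\<^sub>s * \<bar>I l (n + 1) i\<bar> \<le> \<epsilon> * (K * (?\<tau> + 4 / \<Delta>x))"
    by (simp add: abs_mult)
  then show ?thesis using \<sigma>\<^sub>s by (simp add: field_simps)
qed

text \<open>By the scheme the defect equals the Lax-Friedrichs, absorption and time-derivative
  terms, all of which carry a factor \<open>\<epsilon>\<close>.\<close>

lemma flux_defect_bound:
  assumes "scheme \<epsilon> C I" "0 < \<epsilon>" "\<epsilon> \<le> 1" "i \<in> C"
    and hat: "\<And>j. j \<in> {i - 1..i + 1} \<Longrightarrow> \<bar>I1_hat \<epsilon> I (n + 1) j\<bar> \<le> K"
    and I1: "\<bar>I 1 n i\<bar> \<le> K"
  shows "\<bar>flux_defect \<sigma>\<^sub>s \<Delta>x \<epsilon> I n i\<bar> \<le> \<epsilon> * (K * (\<sigma>\<^sub>a + 2 / (c * \<Delta>t) + 2 / \<Delta>x))"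
proof -
  let ?\<tau> = "1 / (c * \<Delta>t)"
  let ?w = "I1_hat \<epsilon> I (n + 1)"
  have \<tau>: "?\<tau> > 0" using c \<Delta>t by simp
  have K: "K \<ge> 0" using I1 by auto
  have "\<epsilon>\<^sup>2 / c * ((?w i - I1_hat \<epsilon> I n i) / \<Delta>t)
      + pn_a 0 * central_diff \<Delta>x (I 0 (n + 1)) i - \<epsilon> * lax_friedrichs \<Delta>x ?w i
      + pn_b 2 * central_diff \<Delta>x (I 2 n) i = - (\<epsilon>\<^sup>2 * \<sigma>\<^sub>a + \<sigma>\<^sub>s) * ?w i"
    using assms(1,4) by (simp add: imex_pn_scheme_def)
  \<comment> \<open>One power of \<open>\<epsilon>\<close> cancels the scaling of the old flux, so
    only the unscaled \<open>I 1 n\<close> has to be bounded. This matters at level 0, where the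
    rescaled initial flux may blow up.\<close>
  moreover have "\<epsilon>\<^sup>2 / c * ((?w i - I1_hat \<epsilon> I n i) / \<Delta>t) = \<epsilon> * (?\<tau> * (\<epsilon> * ?w i - I 1 n i))"
    using assms(2) c \<Delta>t by (simp add: I1_hat_def[of _ _ n] power2_eq_square field_simps)
  ultimately have eq: "flux_defect \<sigma>\<^sub>s \<Delta>x \<epsilon> I n i
      = \<epsilon> * (lax_friedrichs \<Delta>x ?w i - \<epsilon> * \<sigma>\<^sub>a * ?w i - ?\<tau> * (\<epsilon> * ?w i - I 1 n i))"
    unfolding flux_defect_def by (simp add: power2_eq_square algebra_simps)
  have w: "\<bar>\<epsilon> * ?w i\<bar> \<le> 1 * K"
    using assms(2,3) hat[of i] K unfolding abs_mult by (intro mult_mono) auto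
  then have "\<bar>\<sigma>\<^sub>a * (\<epsilon> * ?w i)\<bar> \<le> \<sigma>\<^sub>a * (1 * K)"
    using \<sigma>\<^sub>a unfolding abs_mult[of \<sigma>\<^sub>a] by (intro mult_mono) auto
  moreover have "\<bar>\<epsilon> * ?w i - I 1 n i\<bar> \<le> 2 * K" using w I1 by linarith
  then have "\<bar>?\<tau> * (\<epsilon> * ?w i - I 1 n i)\<bar> \<le> ?\<tau> * (2 * K)"
    using \<tau> unfolding abs_mult[of ?\<tau>] by (intro mult_mono) auto
  moreover have "\<bar>lax_friedrichs \<Delta>x ?w i\<bar> \<le> 2 * K / \<Delta>x"
    using hat \<Delta>x by (intro lax_friedrichs_bound) auto
  moreover have "K * (\<sigma>\<^sub>a + 2 / (c * \<Delta>t) + 2 / \<Delta>x) = \<sigma>\<^sub>a * (1 * K) + ?\<tau> * (2 * K) + 2 * K / \<Delta>x"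
    by (simp add: algebra_simps)
  moreover have "\<epsilon> * \<sigma>\<^sub>a * ?w i = \<sigma>\<^sub>a * (\<epsilon> * ?w i)" by simp
  ultimately have "\<bar>lax_friedrichs \<Delta>x ?w i - \<epsilon> * \<sigma>\<^sub>a * ?w i - ?\<tau> * (\<epsilon> * ?w i - I 1 n i)\<bar>
      \<le> K * (\<sigma>\<^sub>a + 2 / (c * \<Delta>t) + 2 / \<Delta>x)"
    by linarith
  then show ?thesis using assms(2) by (simp add: eq abs_mult)
qed

text \<open>An exact identity: the flux in the equation for \<open>I 0\<close> is expressed through
  the defect and the gradients of \<open>I 0\<close> and \<open>I 2\<close>. The value
  \<open>pn_a 0 = 1/3\<close> produces the diffusion coefficient
  \<open>1 / (3 * \<sigma>\<^sub>s)\<close>.\<close>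

lemma residual_eq_flux_defect:
  assumes "scheme \<epsilon> C I" "i \<in> C"
  shows "residual (I 0) n i = (pn_b 2 * central_diff \<Delta>x (central_diff \<Delta>x (I 2 n)) i
           - central_diff \<Delta>x (flux_defect \<sigma>\<^sub>s \<Delta>x \<epsilon> I n) i) / \<sigma>\<^sub>s"
proof -
  let ?w = "I1_hat \<epsilon> I (n + 1)"
  have "1 / c * ((I 0 (n + 1) i - I 0 n i) / \<Delta>t) - lax_friedrichs \<Delta>x (I 0 (n + 1)) i
      + \<sigma>\<^sub>a * I 0 (n + 1) i = - central_diff \<Delta>x ?w i"
    using assms by (simp add: imex_pn_scheme_def algebra_simps)
  moreover have "residual (I 0) n i
      = 1 / c * ((I 0 (n + 1) i - I 0 n i) / \<Delta>t) - lax_friedrichs \<Delta>x (I 0 (n + 1)) i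
        + \<sigma>\<^sub>a * I 0 (n + 1) i - 1 / (3 * \<sigma>\<^sub>s) * central_diff \<Delta>x (central_diff \<Delta>x (I 0 (n + 1))) i"
    by (simp add: five_point_residual_def central_diff_def lax_friedrichs_def power2_eq_square
        diff_divide_distrib add_divide_distrib algebra_simps)
  ultimately have "residual (I 0) n i = - central_diff \<Delta>x ?w i
      - 1 / (3 * \<sigma>\<^sub>s) * central_diff \<Delta>x (central_diff \<Delta>x (I 0 (n + 1))) i"
    by linarith
  moreover have "central_diff \<Delta>x (flux_defect \<sigma>\<^sub>s \<Delta>x \<epsilon> I n) i = \<sigma>\<^sub>s * central_diff \<Delta>x ?w i
      + 1 / 3 * central_diff \<Delta>x (central_diff \<Delta>x (I 0 (n + 1))) i
      + pn_b 2 * central_diff \<Delta>x (central_diff \<Delta>x (I 2 n)) i"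
    unfolding flux_defect_def[abs_def] central_diff_linear by (simp add: pn_a_def)
  ultimately show ?thesis using \<sigma>\<^sub>s by (simp add: field_simps)
qed

text \<open>Splitting off the old level presents the new one as the unknown of an implicit equation,
  whose \<open>\<alpha>\<close> is positive even for \<open>\<sigma>\<^sub>a = 0\<close>.\<close>

lemma residual_eq_implicit_op:
  "residual U n i = implicit_op (1 / (c * \<Delta>t) + \<sigma>\<^sub>a) (1 / (3 * \<sigma>\<^sub>s * (2 * \<Delta>x)\<^sup>2)) (1 / (2 * \<Delta>x)) (U (n + 1)) i
     - U n i / (c * \<Delta>t)"
  by (simp add: five_point_residual_def implicit_op_def v_max_def diff_divide_distrib
      add_divide_distrib algebra_simps)

lemma residual_mean_intensity: "residual (mean_intensity I) n i = residual (I 0) n i / 2"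
  by (simp add: five_point_residual_def mean_intensity_def diff_divide_distrib add_divide_distrib
      algebra_simps)

subsection \<open>The limit of vanishing \<open>\<epsilon>\<close>\<close>

text \<open>The equation of moment \<open>M\<close> reads moment \<open>M + 1\<close>, which the
  closure sets to zero.\<close>

lemma top_moment_bound:
  assumes "\<And>\<epsilon>. \<epsilon> > 0 \<Longrightarrow> scheme \<epsilon> C (I \<epsilon>)"
    and "\<And>l n i. l \<le> M \<Longrightarrow> \<exists>K. \<forall>\<^sub>F \<epsilon> in at_right 0. \<bar>I \<epsilon> l n i\<bar> \<le> K"
    and "l \<le> M + 1"
  shows "\<exists>K. \<forall>\<^sub>F \<epsilon> in at_right 0. \<bar>I \<epsilon> l n i\<bar> \<le> K"
proof (cases "l \<le> M")
  case False
  with assms(3) have l: "l = M + 1" by simp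
  have "\<forall>\<^sub>F \<epsilon> in at_right 0. \<bar>I \<epsilon> l n i\<bar> \<le> 0"
    using eventually_at_right_unit
    by eventually_elim (simp add: scheme_closure[OF assms(1) l])
  then show ?thesis ..
qed (use assms(2) in blast)

text \<open>The stencil involves finitely many values, so their separate bounds have a common
  constant and \<open>moment_bound\<close> gives order \<open>\<epsilon>\<close>. Index
  \<open>M + 1\<close> is included so that moment 2 is covered also for
  \<open>M = 1\<close>.\<close>

lemma moment_tendsto_zero:
  assumes scheme: "\<And>\<epsilon>. \<epsilon> > 0 \<Longrightarrow> scheme \<epsilon> C (I \<epsilon>)"
    and bound: "\<And>l n i. l \<le> M \<Longrightarrow> \<exists>K. \<forall>\<^sub>F \<epsilon> in at_right 0. \<bar>I \<epsilon> l n i\<bar> \<le> K"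
    and "i \<in> C" "l \<in> {2..M + 1}"
  shows "((\<lambda>\<epsilon>. I \<epsilon> l (n + 1) i) \<longlongrightarrow> 0) (at_right 0)"
proof (cases "l = M + 1")
  case True
  have "\<forall>\<^sub>F \<epsilon> in at_right 0. I \<epsilon> l (n + 1) i = 0"
    using eventually_at_right_unit
    by eventually_elim (simp add: scheme_closure[OF scheme True])
  then show ?thesis by (rule tendsto_eventually)
next
  case False
  let ?J = "{..M + 1} \<times> {n, n + 1} \<times> {i - 1..i + 1}"
  let ?P = "\<lambda>K (l, m, j) \<epsilon>. \<bar>I \<epsilon> l m j\<bar> \<le> K"
  have "\<exists>K. \<forall>\<^sub>F \<epsilon> in at_right 0. \<forall>p\<in>?J. ?P K p \<epsilon>"
  proof (rule eventually_common_bound)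
    fix p assume "p \<in> ?J"
    then show "\<exists>K. eventually (?P K p) (at_right 0)"
      using top_moment_bound[where I = I, OF scheme bound] by (auto split: prod.splits)
  qed auto
  then obtain K where "\<forall>\<^sub>F \<epsilon> in at_right 0. \<forall>p\<in>?J. ?P K p \<epsilon>" ..
  with eventually_at_right_unit
  have "\<forall>\<^sub>F \<epsilon> in at_right 0. \<bar>I \<epsilon> l (n + 1) i\<bar> \<le> \<epsilon> * (K * (1 / (c * \<Delta>t) + 4 / \<Delta>x) / \<sigma>\<^sub>s)"
  proof eventually_elim
    case (elim \<epsilon>)
    show ?case
      by (rule moment_bound[OF scheme]) (use elim assms(3,4) False in auto)
  qed
  then show ?thesis by (rule tendsto_zero_at_right_linear)
qed

text \<open>What remains in the residual identity is the central difference of the defect, of order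
  \<open>\<epsilon>\<close>. The contribution of \<open>I 2\<close> at the old level is kept apart,
  since for initial data it need not be small.\<close>

lemma residual_diff_tendsto_zero:
  assumes scheme: "\<And>\<epsilon>. \<epsilon> > 0 \<Longrightarrow> scheme \<epsilon> C (I \<epsilon>)"
    and bound: "\<And>l n i. l \<le> M \<Longrightarrow> \<exists>K. \<forall>\<^sub>F \<epsilon> in at_right 0. \<bar>I \<epsilon> l n i\<bar> \<le> K"
    and hat: "\<And>i. \<exists>K. \<forall>\<^sub>F \<epsilon> in at_right 0. \<bar>I1_hat \<epsilon> (I \<epsilon>) (n + 1) i\<bar> \<le> K"
    and C: "{i - 1..i + 1} \<subseteq> C"
  shows "((\<lambda>\<epsilon>. residual (I \<epsilon> 0) n i
            - pn_b 2 / \<sigma>\<^sub>s * central_diff \<Delta>x (central_diff \<Delta>x (I \<epsilon> 2 n)) i) \<longlongrightarrow> 0) (at_right 0)"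
proof -
  have defect: "((\<lambda>\<epsilon>. flux_defect \<sigma>\<^sub>s \<Delta>x \<epsilon> (I \<epsilon>) n j) \<longlongrightarrow> 0) (at_right 0)" if "j \<in> C" for j
  proof -
    let ?P = "\<lambda>K k \<epsilon>. \<bar>I1_hat \<epsilon> (I \<epsilon>) (n + 1) k\<bar> \<le> K \<and> \<bar>I \<epsilon> 1 n k\<bar> \<le> K"
    have "\<exists>K. \<forall>\<^sub>F \<epsilon> in at_right 0. \<forall>k\<in>{j - 1..j + 1}. ?P K k \<epsilon>"
    proof (rule eventually_common_bound)
      fix k
      obtain K1 K2 where "\<forall>\<^sub>F \<epsilon> in at_right 0. \<bar>I1_hat \<epsilon> (I \<epsilon>) (n + 1) k\<bar> \<le> K1"
        "\<forall>\<^sub>F \<epsilon> in at_right 0. \<bar>I \<epsilon> 1 n k\<bar> \<le> K2"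
        using hat bound[OF M] by blast
      then have "eventually (?P (max K1 K2) k) (at_right 0)" by eventually_elim auto
      then show "\<exists>K. eventually (?P K k) (at_right 0)" ..
    qed auto
    then obtain K where "\<forall>\<^sub>F \<epsilon> in at_right 0. \<forall>k\<in>{j - 1..j + 1}. ?P K k \<epsilon>" ..
    with eventually_at_right_unit
    have "\<forall>\<^sub>F \<epsilon> in at_right 0. \<bar>flux_defect \<sigma>\<^sub>s \<Delta>x \<epsilon> (I \<epsilon>) n j\<bar>
            \<le> \<epsilon> * (K * (\<sigma>\<^sub>a + 2 / (c * \<Delta>t) + 2 / \<Delta>x))"
    proof eventually_elim
      case (elim \<epsilon>)
      show ?case
        by (rule flux_defect_bound[OF scheme]) (use elim that in auto)
    qed
    then show ?thesis by (rule tendsto_zero_at_right_linear)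
  qed
  have "((\<lambda>\<epsilon>. - central_diff \<Delta>x (flux_defect \<sigma>\<^sub>s \<Delta>x \<epsilon> (I \<epsilon>) n) i / \<sigma>\<^sub>s)
      \<longlongrightarrow> - ((0 - 0) / (2 * \<Delta>x)) / \<sigma>\<^sub>s) (at_right 0)"
    unfolding central_diff_def using C \<sigma>\<^sub>s \<Delta>x by (intro tendsto_intros defect) auto
  then have "((\<lambda>\<epsilon>. - central_diff \<Delta>x (flux_defect \<sigma>\<^sub>s \<Delta>x \<epsilon> (I \<epsilon>) n) i / \<sigma>\<^sub>s) \<longlongrightarrow> 0) (at_right 0)"
    by simp
  then show ?thesis
  proof (rule Lim_transform_eventually)
    show "\<forall>\<^sub>F \<epsilon> in at_right 0. - central_diff \<Delta>x (flux_defect \<sigma>\<^sub>s \<Delta>x \<epsilon> (I \<epsilon>) n) i / \<sigma>\<^sub>s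
        = residual (I \<epsilon> 0) n i - pn_b 2 / \<sigma>\<^sub>s * central_diff \<Delta>x (central_diff \<Delta>x (I \<epsilon> 2 n)) i"
      using eventually_at_right_unit
    proof eventually_elim
      case (elim \<epsilon>)
      have "i \<in> C" using C by auto
      then show ?case
        using elim residual_eq_flux_defect[OF scheme, of \<epsilon> i n] by (simp add: diff_divide_distrib)
    qed
  qed
qed

text \<open>The old second moment vanishes in the limit because the previous step has already
  relaxed it; at level 0 this has to be assumed. The iterated central difference reads it in the
  cells \<open>i - 2\<close>, \<open>i\<close> and \<open>i + 2\<close>, whence the wider
  stencil.\<close>

lemma residual_tendsto_zero:
  assumes scheme: "\<And>\<epsilon>. \<epsilon> > 0 \<Longrightarrow> scheme \<epsilon> C (I \<epsilon>)"
    and bound: "\<And>l n i. l \<le> M \<Longrightarrow> \<exists>K. \<forall>\<^sub>F \<epsilon> in at_right 0. \<bar>I \<epsilon> l n i\<bar> \<le> K"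
    and hat: "\<And>i. \<exists>K. \<forall>\<^sub>F \<epsilon> in at_right 0. \<bar>I1_hat \<epsilon> (I \<epsilon>) (n + 1) i\<bar> \<le> K"
    and C: "{i - 2..i + 2} \<subseteq> C"
    and prepared: "n \<ge> 1 \<or> (\<forall>j\<in>C. ((\<lambda>\<epsilon>. I \<epsilon> 2 0 j) \<longlongrightarrow> 0) (at_right 0))"
  shows "((\<lambda>\<epsilon>. residual (I \<epsilon> 0) n i) \<longlongrightarrow> 0) (at_right 0)"
proof -
  have I2: "((\<lambda>\<epsilon>. I \<epsilon> 2 n j) \<longlongrightarrow> 0) (at_right 0)" if "j \<in> C" for j
  proof (cases n)
    case 0
    then show ?thesis using prepared that by auto
  next
    case (Suc m)
    then show ?thesis
      using moment_tendsto_zero[where I = I, OF scheme bound that, of 2 m] M by auto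
  qed
  have "((\<lambda>\<epsilon>. pn_b 2 / \<sigma>\<^sub>s * central_diff \<Delta>x (central_diff \<Delta>x (I \<epsilon> 2 n)) i)
      \<longlongrightarrow> pn_b 2 / \<sigma>\<^sub>s * (((0 - 0) / (2 * \<Delta>x) - (0 - 0) / (2 * \<Delta>x)) / (2 * \<Delta>x))) (at_right 0)"
    unfolding central_diff_def using C \<Delta>x by (intro tendsto_intros I2) auto
  moreover have "{i - 1..i + 1} \<subseteq> C" using C by auto
  note residual_diff_tendsto_zero[where I = I, OF scheme bound hat this]
  ultimately show ?thesis using tendsto_add by fastforce
qed

section \<open>Bounds uniform in \<open>\<epsilon>\<close> on the unbounded mesh\<close>

text \<open>The equations for \<open>I 0\<close> and the rescaled \<open>I 1\<close> form the system
  of \<open>coupled_stability\<close>, with all old values and the explicit second moment moved into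
  the data \<open>f\<close> and \<open>h\<close>.\<close>

lemma first_pair_bound:
  assumes scheme: "\<And>\<epsilon>. \<epsilon> > 0 \<Longrightarrow> scheme \<epsilon> UNIV (I \<epsilon>)"
    and bdd: "\<And>\<epsilon> l n. \<epsilon> > 0 \<Longrightarrow> l \<le> M \<Longrightarrow> bounded (range (I \<epsilon> l n))"
    and prev: "\<forall>\<^sub>F \<epsilon> in at_right 0. \<forall>l\<le>M. \<forall>i. \<bar>I \<epsilon> l n i\<bar> \<le> K"
  shows "\<exists>K. \<forall>\<^sub>F \<epsilon> in at_right 0. \<forall>i. \<bar>I \<epsilon> 0 (n + 1) i\<bar> \<le> K \<and> \<bar>I1_hat \<epsilon> (I \<epsilon>) (n + 1) i\<bar> \<le> K"
proof -
  let ?\<tau> = "1 / (c * \<Delta>t)"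
  have \<tau>: "?\<tau> > 0" using c \<Delta>t by simp
  have pos: "?\<tau> + \<sigma>\<^sub>a > 0" using \<tau> \<sigma>\<^sub>a by linarith
  obtain \<epsilon>\<^sub>0 K' where \<epsilon>\<^sub>0: "\<epsilon>\<^sub>0 > 0"
    and stab: "\<And>\<epsilon> \<beta> u w f h i. \<lbrakk>0 < \<epsilon>; \<epsilon> < \<epsilon>\<^sub>0; \<sigma>\<^sub>s \<le> \<beta>; bounded (range u); bounded (range w);
           \<And>i. \<bar>f i\<bar> \<le> ?\<tau> * K; \<And>i. \<bar>h i\<bar> \<le> ?\<tau> * K + K / \<Delta>x;
           \<And>i. (?\<tau> + \<sigma>\<^sub>a) * u i + central_diff \<Delta>x w i - lax_friedrichs \<Delta>x u i = f i;
           \<And>i. \<beta> * w i + 1 / 3 * central_diff \<Delta>x u i - \<epsilon> * lax_friedrichs \<Delta>x w i = h i\<rbrakk>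
         \<Longrightarrow> \<bar>u i\<bar> \<le> K' \<and> \<bar>w i\<bar> \<le> K'"
    using coupled_stability[OF pos \<sigma>\<^sub>s \<Delta>x] by blast
  have "\<forall>\<^sub>F \<epsilon> in at_right 0. \<epsilon> < \<epsilon>\<^sub>0"
    using \<epsilon>\<^sub>0 by (auto simp: eventually_at_right_field)
  with eventually_at_right_unit prev
  have "\<forall>\<^sub>F \<epsilon> in at_right 0. \<forall>i. \<bar>I \<epsilon> 0 (n + 1) i\<bar> \<le> K' \<and> \<bar>I1_hat \<epsilon> (I \<epsilon>) (n + 1) i\<bar> \<le> K'"
  proof eventually_elim
    case (elim \<epsilon>)
    let ?u = "I \<epsilon> 0 (n + 1)" and ?w = "I1_hat \<epsilon> (I \<epsilon>) (n + 1)"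
    let ?f = "\<lambda>i. ?\<tau> * I \<epsilon> 0 n i"
    let ?h = "\<lambda>i. \<epsilon> * ?\<tau> * I \<epsilon> 1 n i - pn_b 2 * central_diff \<Delta>x (I \<epsilon> 2 n) i"
    have K: "K \<ge> 0" using elim(2) abs_ge_zero order_trans by blast
    have I2: "\<bar>I \<epsilon> 2 n i\<bar> \<le> K" for i
    proof (cases "2 \<le> M")
      case False
      then have "2 = M + 1" using M by simp
      from scheme_closure[OF scheme this] show ?thesis using elim(1) K by simp
    qed (use elim(2) in auto)
    have "\<bar>?u i\<bar> \<le> K' \<and> \<bar>?w i\<bar> \<le> K'" for i
    proof (rule stab[where f = ?f and h = ?h and \<beta> = "\<epsilon>\<^sup>2 * ?\<tau> + \<epsilon>\<^sup>2 * \<sigma>\<^sub>a + \<sigma>\<^sub>s" and \<epsilon> = \<epsilon>])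
      show "0 < \<epsilon>" "\<epsilon> < \<epsilon>\<^sub>0" using elim by auto
      show "\<sigma>\<^sub>s \<le> \<epsilon>\<^sup>2 * ?\<tau> + \<epsilon>\<^sup>2 * \<sigma>\<^sub>a + \<sigma>\<^sub>s" using \<tau> \<sigma>\<^sub>a by simp
      show "bounded (range ?u)" using bdd elim(1) by blast
      \<comment> \<open>The bound \<open>B / \<epsilon>\<close> degenerates with
        \<open>\<epsilon>\<close>, but stability asks only for finiteness at each fixed
        \<open>\<epsilon>\<close>.\<close>
      show "bounded (range ?w)"
      proof -
        obtain B where B: "\<And>j. \<bar>I \<epsilon> 1 (n + 1) j\<bar> \<le> B"
          using bdd[of \<epsilon> 1 "n + 1"] elim(1) M by (auto simp: bounded_iff)
        have "\<bar>?w j\<bar> \<le> B / \<epsilon>" for j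
          using B[of j] elim(1) by (simp add: I1_hat_def divide_right_mono)
        then show ?thesis by (auto simp: bounded_iff)
      qed
      show "\<bar>?f i\<bar> \<le> ?\<tau> * K" for i
        using elim(2) \<tau> unfolding abs_mult by (intro mult_mono) auto
      show "\<bar>?h i\<bar> \<le> ?\<tau> * K + K / \<Delta>x" for i
      proof -
        have "\<bar>\<epsilon> * ?\<tau> * I \<epsilon> 1 n i\<bar> \<le> 1 * ?\<tau> * K"
          using elim(1,2) \<tau> K M unfolding abs_mult by (intro mult_mono) auto
        moreover have "\<bar>pn_b 2 * central_diff \<Delta>x (I \<epsilon> 2 n) i\<bar> \<le> 1 * (K / \<Delta>x)"
          unfolding abs_mult using K \<Delta>x I2
          by (intro mult_mono central_diff_bound) (auto simp: pn_b_def)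
        ultimately show ?thesis by linarith
      qed
      show "(?\<tau> + \<sigma>\<^sub>a) * ?u i + central_diff \<Delta>x ?w i - lax_friedrichs \<Delta>x ?u i = ?f i" for i
      proof -
        have "1 / c * ((?u i - I \<epsilon> 0 n i) / \<Delta>t) + central_diff \<Delta>x ?w i - lax_friedrichs \<Delta>x ?u i
            = - \<sigma>\<^sub>a * ?u i"
          using scheme[of \<epsilon>] elim(1) by (simp add: imex_pn_scheme_def)
        then show ?thesis by (simp add: diff_divide_distrib algebra_simps)
      qed
      show "(\<epsilon>\<^sup>2 * ?\<tau> + \<epsilon>\<^sup>2 * \<sigma>\<^sub>a + \<sigma>\<^sub>s) * ?w i + 1 / 3 * central_diff \<Delta>x ?u i
          - \<epsilon> * lax_friedrichs \<Delta>x ?w i = ?h i" for i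
      proof -
        have "\<epsilon>\<^sup>2 / c * ((?w i - I1_hat \<epsilon> (I \<epsilon>) n i) / \<Delta>t) + pn_a 0 * central_diff \<Delta>x ?u i
            - \<epsilon> * lax_friedrichs \<Delta>x ?w i + pn_b 2 * central_diff \<Delta>x (I \<epsilon> 2 n) i
            = - (\<epsilon>\<^sup>2 * \<sigma>\<^sub>a + \<sigma>\<^sub>s) * ?w i"
          using scheme[of \<epsilon>] elim(1) by (simp add: imex_pn_scheme_def)
        moreover have "\<epsilon>\<^sup>2 / c * ((?w i - I1_hat \<epsilon> (I \<epsilon>) n i) / \<Delta>t)
            = \<epsilon>\<^sup>2 * ?\<tau> * ?w i - \<epsilon> * ?\<tau> * I \<epsilon> 1 n i"
          using elim(1) c \<Delta>t by (simp add: I1_hat_def[of _ _ n] power2_eq_square field_simps)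
        ultimately show ?thesis by (simp add: pn_a_def algebra_simps)
      qed
    qed
    then show ?case by blast
  qed
  then show ?thesis ..
qed

text \<open>The moments are treated in the order in which the scheme computes them: first the
  coupled pair, then moment \<open>Suc l\<close> from moment \<open>l\<close> at the new level and
  from old values.\<close>

lemma uniform_bound_step:
  assumes scheme: "\<And>\<epsilon>. \<epsilon> > 0 \<Longrightarrow> scheme \<epsilon> UNIV (I \<epsilon>)"
    and bdd: "\<And>\<epsilon> l n. \<epsilon> > 0 \<Longrightarrow> l \<le> M \<Longrightarrow> bounded (range (I \<epsilon> l n))"
    and prev: "\<forall>\<^sub>F \<epsilon> in at_right 0. \<forall>l\<le>M. \<forall>i. \<bar>I \<epsilon> l n i\<bar> \<le> K"
  shows "\<exists>K. \<forall>\<^sub>F \<epsilon> in at_right 0. \<forall>l\<le>M. \<forall>i. \<bar>I \<epsilon> l (n + 1) i\<bar> \<le> K"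
proof -
  obtain K1 where K1: "\<forall>\<^sub>F \<epsilon> in at_right 0.
      \<forall>i. \<bar>I \<epsilon> 0 (n + 1) i\<bar> \<le> K1 \<and> \<bar>I1_hat \<epsilon> (I \<epsilon>) (n + 1) i\<bar> \<le> K1"
    using first_pair_bound[where I = I, OF scheme bdd prev] by blast
  have "\<exists>K. \<forall>\<^sub>F \<epsilon> in at_right 0. \<forall>i. \<bar>I \<epsilon> l (n + 1) i\<bar> \<le> K" if "l \<le> M" for l
    using that
  proof (induction l)
    case 0
    from K1 have "\<forall>\<^sub>F \<epsilon> in at_right 0. \<forall>i. \<bar>I \<epsilon> 0 (n + 1) i\<bar> \<le> K1" by eventually_elim auto
    then show ?case ..
  next
    case (Suc l)
    show ?case
    proof (cases "l = 0")
      case True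
      have "\<forall>\<^sub>F \<epsilon> in at_right 0. \<forall>i. \<bar>I \<epsilon> 1 (n + 1) i\<bar> \<le> K1"
        using K1 eventually_at_right_unit
      proof eventually_elim
        case (elim \<epsilon>)
        show ?case
        proof
          fix i
          have "I \<epsilon> 1 (n + 1) i = \<epsilon> * I1_hat \<epsilon> (I \<epsilon>) (n + 1) i"
            using elim(2) by (simp add: I1_hat_def)
          moreover have "\<bar>\<epsilon> * I1_hat \<epsilon> (I \<epsilon>) (n + 1) i\<bar> \<le> 1 * K1"
            unfolding abs_mult using elim by (intro mult_mono) auto
          ultimately show "\<bar>I \<epsilon> 1 (n + 1) i\<bar> \<le> K1" by simp
        qed
      qed
      then show ?thesis using True by auto
    next
      case False
      from Suc obtain K2 where "\<forall>\<^sub>F \<epsilon> in at_right 0. \<forall>i. \<bar>I \<epsilon> l (n + 1) i\<bar> \<le> K2" by auto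
      with prev eventually_at_right_unit
      have "\<forall>\<^sub>F \<epsilon> in at_right 0. \<forall>i. \<bar>I \<epsilon> (Suc l) (n + 1) i\<bar>
              \<le> 1 * (max K K2 * (1 / (c * \<Delta>t) + 4 / \<Delta>x) / \<sigma>\<^sub>s)"
      proof eventually_elim
        case (elim \<epsilon>)
        have K: "K \<ge> 0" using elim(1) abs_ge_zero order_trans by blast
        \<comment> \<open>The upper neighbour of the last moment lies outside the range of
          \<open>prev\<close>; there the closure value zero is used.\<close>
        have "\<bar>I \<epsilon> (Suc (Suc l)) n j\<bar> \<le> K" for j
        proof (cases "Suc l = M")
          case True
          then have "Suc (Suc l) = M + 1" by simp
          from scheme_closure[OF scheme this] show ?thesis using elim(2) K by simp
        qed (use elim(1) Suc.prems in auto)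
        then have "\<bar>I \<epsilon> (Suc l) (n + 1) i\<bar> \<le> \<epsilon> * (max K K2 * (1 / (c * \<Delta>t) + 4 / \<Delta>x) / \<sigma>\<^sub>s)" for i
          using elim Suc.prems False
          by (intro moment_bound[OF scheme]) (auto simp: le_max_iff_disj)
        moreover have "\<epsilon> * (max K K2 * (1 / (c * \<Delta>t) + 4 / \<Delta>x) / \<sigma>\<^sub>s)
            \<le> 1 * (max K K2 * (1 / (c * \<Delta>t) + 4 / \<Delta>x) / \<sigma>\<^sub>s)"
          using elim(2) K c \<Delta>t \<Delta>x \<sigma>\<^sub>s by (intro mult_right_mono divide_nonneg_pos mult_nonneg_nonneg) auto
        ultimately show ?case by (meson order_trans)
      qed
      then show ?thesis ..
    qed
  qed
  then have "\<exists>K. \<forall>\<^sub>F \<epsilon> in at_right 0. \<forall>l\<in>{..M}. \<forall>i. \<bar>I \<epsilon> l (n + 1) i\<bar> \<le> K"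
    by (intro eventually_common_bound[where P = "\<lambda>K l \<epsilon>. \<forall>i. \<bar>I \<epsilon> l (n + 1) i\<bar> \<le> K"])
      (auto intro: order_trans)
  then show ?thesis unfolding Ball_def atMost_iff .
qed

lemma uniform_bound:
  assumes scheme: "\<And>\<epsilon>. \<epsilon> > 0 \<Longrightarrow> scheme \<epsilon> UNIV (I \<epsilon>)"
    and bdd: "\<And>\<epsilon> l n. \<epsilon> > 0 \<Longrightarrow> l \<le> M \<Longrightarrow> bounded (range (I \<epsilon> l n))"
    and init: "\<exists>K. \<forall>\<^sub>F \<epsilon> in at_right 0. \<forall>l\<le>M. \<forall>i. \<bar>I \<epsilon> l 0 i\<bar> \<le> K"
  shows "\<exists>K. \<forall>\<^sub>F \<epsilon> in at_right 0. \<forall>l\<le>M. \<forall>i. \<bar>I \<epsilon> l n i\<bar> \<le> K"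
proof (induction n)
  case (Suc n)
  then obtain K where "\<forall>\<^sub>F \<epsilon> in at_right 0. \<forall>l\<le>M. \<forall>i. \<bar>I \<epsilon> l n i\<bar> \<le> K" ..
  from uniform_bound_step[where I = I, OF scheme bdd this] show ?case by simp
qed (rule init)

text \<open>Induction over the time levels: if \<open>I 0\<close> and \<open>I 2\<close> converge at
  the old level, the implicit operator applied to the new \<open>I 0\<close> converges in each cell,
  and hence so does \<open>I 0\<close> itself. The residual then passes to the limit.\<close>

lemma unbounded_mesh_limit:
  assumes scheme: "\<And>\<epsilon>. \<epsilon> > 0 \<Longrightarrow> scheme \<epsilon> UNIV (I \<epsilon>)"
    and bdd: "\<And>\<epsilon> l n. \<epsilon> > 0 \<Longrightarrow> l \<le> M \<Longrightarrow> bounded (range (I \<epsilon> l n))"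
    and init: "\<exists>K. \<forall>\<^sub>F \<epsilon> in at_right 0. \<forall>l\<le>M. \<forall>i. \<bar>I \<epsilon> l 0 i\<bar> \<le> K"
    and init_lim: "\<And>l i. l \<le> M \<Longrightarrow> ((\<lambda>\<epsilon>. I \<epsilon> l 0 i) \<longlongrightarrow> g l i) (at_right 0)"
  shows "\<exists>U. (\<forall>n i. ((\<lambda>\<epsilon>. mean_intensity (I \<epsilon>) n i) \<longlongrightarrow> U n i) (at_right 0))
           \<and> (\<forall>n i. n \<ge> 1 \<or> (\<forall>j. ((\<lambda>\<epsilon>. I \<epsilon> 2 0 j) \<longlongrightarrow> 0) (at_right 0)) \<longrightarrow> residual U n i = 0)" (is ?thesis1)
    and "l \<in> {1..M} \<Longrightarrow> n \<ge> 1 \<Longrightarrow> ((\<lambda>\<epsilon>. I \<epsilon> l n i) \<longlongrightarrow> 0) (at_right 0)"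
proof -
  note ub = uniform_bound[where I = I, OF scheme bdd init]
  have bound: "\<exists>K. \<forall>\<^sub>F \<epsilon> in at_right 0. \<bar>I \<epsilon> l n i\<bar> \<le> K" if "l \<le> M" for l n i
  proof -
    obtain K where "\<forall>\<^sub>F \<epsilon> in at_right 0. \<forall>l\<le>M. \<forall>i. \<bar>I \<epsilon> l n i\<bar> \<le> K" using ub by blast
    then have "\<forall>\<^sub>F \<epsilon> in at_right 0. \<bar>I \<epsilon> l n i\<bar> \<le> K" by eventually_elim (use that in auto)
    then show ?thesis ..
  qed
  have hat: "\<exists>K. \<forall>\<^sub>F \<epsilon> in at_right 0. \<bar>I1_hat \<epsilon> (I \<epsilon>) (n + 1) i\<bar> \<le> K" for n i
  proof -
    obtain K where "\<forall>\<^sub>F \<epsilon> in at_right 0. \<forall>l\<le>M. \<forall>i. \<bar>I \<epsilon> l n i\<bar> \<le> K" using ub by blast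
    from first_pair_bound[where I = I, OF scheme bdd this] obtain K' where
      "\<forall>\<^sub>F \<epsilon> in at_right 0. \<forall>i. \<bar>I \<epsilon> 0 (n + 1) i\<bar> \<le> K' \<and> \<bar>I1_hat \<epsilon> (I \<epsilon>) (n + 1) i\<bar> \<le> K'" ..
    then have "\<forall>\<^sub>F \<epsilon> in at_right 0. \<bar>I1_hat \<epsilon> (I \<epsilon>) (n + 1) i\<bar> \<le> K'" by eventually_elim auto
    then show ?thesis ..
  qed
  have moments: "((\<lambda>\<epsilon>. I \<epsilon> l (n + 1) i) \<longlongrightarrow> 0) (at_right 0)" if "l \<in> {2..M + 1}" for l n i
    by (rule moment_tendsto_zero[where I = I, OF scheme bound _ that]) auto
  have first: "((\<lambda>\<epsilon>. I \<epsilon> 1 (n + 1) i) \<longlongrightarrow> 0) (at_right 0)" for n i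
  proof -
    obtain K where "\<forall>\<^sub>F \<epsilon> in at_right 0. \<bar>I1_hat \<epsilon> (I \<epsilon>) (n + 1) i\<bar> \<le> K" using hat by blast
    with eventually_at_right_unit have "\<forall>\<^sub>F \<epsilon> in at_right 0. \<bar>I \<epsilon> 1 (n + 1) i\<bar> \<le> \<epsilon> * K"
      by eventually_elim (simp add: I1_hat_def field_simps)
    then show ?thesis by (rule tendsto_zero_at_right_linear)
  qed
  show "((\<lambda>\<epsilon>. I \<epsilon> l n i) \<longlongrightarrow> 0) (at_right 0)" if "l \<in> {1..M}" "n \<ge> 1"
    using that moments[of l "n - 1" i] first[of "n - 1" i] by (cases "l = 1") auto
  \<comment> \<open>At level 0 the limit stems from the initial data, or from the closure if
    \<open>M = 1\<close>; at later levels it is zero.\<close>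
  have I2: "\<exists>v. ((\<lambda>\<epsilon>. I \<epsilon> 2 n i) \<longlongrightarrow> v) (at_right 0)" for n i
  proof (cases n)
    case 0
    show ?thesis
    proof (cases "2 \<le> M")
      case True
      from init_lim[OF this] show ?thesis unfolding 0 ..
    next
      case False
      then have M1: "2 = M + 1" using M by simp
      have "\<forall>\<^sub>F \<epsilon> in at_right 0. I \<epsilon> 2 n i = 0"
        using eventually_at_right_unit
        by eventually_elim (simp add: scheme_closure[OF scheme M1])
      from tendsto_eventually[OF this] show ?thesis ..
    qed
  next
    case (Suc m)
    have "((\<lambda>\<epsilon>. I \<epsilon> 2 n i) \<longlongrightarrow> 0) (at_right 0)"
      using moments[of 2 m i] M Suc by simp
    then show ?thesis ..
  qed
  let ?op = "implicit_op (1 / (c * \<Delta>t) + \<sigma>\<^sub>a) (1 / (3 * \<sigma>\<^sub>s * (2 * \<Delta>x)\<^sup>2)) (1 / (2 * \<Delta>x))"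
  have I0: "\<exists>v. ((\<lambda>\<epsilon>. I \<epsilon> 0 n i) \<longlongrightarrow> v) (at_right 0)" for n i
  proof (induction n arbitrary: i)
    case 0
    from init_lim[of 0] show ?case by blast
  next
    case (Suc n)
    obtain K where K: "\<forall>\<^sub>F \<epsilon> in at_right 0. \<forall>l\<le>M. \<forall>i. \<bar>I \<epsilon> l (Suc n) i\<bar> \<le> K" using ub by blast
    obtain v0 where v0: "\<And>i. ((\<lambda>\<epsilon>. I \<epsilon> 0 n i) \<longlongrightarrow> v0 i) (at_right 0)" using Suc.IH by metis
    obtain v2 where v2: "\<And>i. ((\<lambda>\<epsilon>. I \<epsilon> 2 n i) \<longlongrightarrow> v2 i) (at_right 0)" using I2 by metis
    show ?case
    proof (rule implicit_op_convergent)
      show "1 / (c * \<Delta>t) + \<sigma>\<^sub>a > 0" "1 / (3 * \<sigma>\<^sub>s * (2 * \<Delta>x)\<^sup>2) \<ge> 0" "1 / (2 * \<Delta>x) \<ge> 0"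
        using c \<Delta>t \<sigma>\<^sub>a \<sigma>\<^sub>s \<Delta>x by (auto intro: add_pos_nonneg)
      show "at_right (0::real) \<noteq> bot" by simp
      show "\<forall>\<^sub>F \<epsilon> in at_right 0. \<bar>I \<epsilon> 0 (Suc n) i\<bar> \<le> K" for i
        using K by (auto elim!: eventually_mono)
      show "\<exists>f. ((\<lambda>\<epsilon>. ?op (I \<epsilon> 0 (Suc n)) i) \<longlongrightarrow> f) (at_right 0)" for i
      proof
        \<comment> \<open>At level 0 the limit of \<open>?D\<close> may be nonzero. Convergence of
          \<open>I 0\<close> needs only that it exists, so it holds for unprepared data too; only
          the equation for the limit needs the second moment to vanish.\<close>
        let ?D = "\<lambda>\<epsilon>. pn_b 2 / \<sigma>\<^sub>s * central_diff \<Delta>x (central_diff \<Delta>x (I \<epsilon> 2 n)) i"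
        have "((\<lambda>\<epsilon>. (residual (I \<epsilon> 0) n i - ?D \<epsilon>) + ?D \<epsilon> + I \<epsilon> 0 n i / (c * \<Delta>t))
            \<longlongrightarrow> 0 + pn_b 2 / \<sigma>\<^sub>s * central_diff \<Delta>x (central_diff \<Delta>x v2) i + v0 i / (c * \<Delta>t)) (at_right 0)"
        proof (intro tendsto_add)
          show "((\<lambda>\<epsilon>. residual (I \<epsilon> 0) n i - ?D \<epsilon>) \<longlongrightarrow> 0) (at_right 0)"
            by (rule residual_diff_tendsto_zero[where I = I, OF scheme bound hat]) auto
          show "(?D \<longlongrightarrow> pn_b 2 / \<sigma>\<^sub>s * central_diff \<Delta>x (central_diff \<Delta>x v2) i) (at_right 0)"
            unfolding central_diff_def using \<Delta>x by (intro tendsto_intros v2) auto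
          show "((\<lambda>\<epsilon>. I \<epsilon> 0 n i / (c * \<Delta>t)) \<longlongrightarrow> v0 i / (c * \<Delta>t)) (at_right 0)"
            using c \<Delta>t by (intro tendsto_intros v0) auto
        qed
        then show "((\<lambda>\<epsilon>. ?op (I \<epsilon> 0 (Suc n)) i) \<longlongrightarrow>
            0 + pn_b 2 / \<sigma>\<^sub>s * central_diff \<Delta>x (central_diff \<Delta>x v2) i + v0 i / (c * \<Delta>t)) (at_right 0)"
          by (simp add: residual_eq_implicit_op)
      qed
    qed
  qed
  then obtain v where v: "\<And>n i. ((\<lambda>\<epsilon>. I \<epsilon> 0 n i) \<longlongrightarrow> v n i) (at_right 0)" by metis
  define U where "U = (\<lambda>n i. v n i / 2)"
  have U: "((\<lambda>\<epsilon>. mean_intensity (I \<epsilon>) n i) \<longlongrightarrow> U n i) (at_right 0)" for n i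
    unfolding mean_intensity_def U_def by (intro tendsto_intros v) auto
  have "residual U n i = 0"
    if "n \<ge> 1 \<or> (\<forall>j. ((\<lambda>\<epsilon>. I \<epsilon> 2 0 j) \<longlongrightarrow> 0) (at_right 0))" for n i
  \<comment> \<open>The residual is built from finitely many grid values, so along the family it
    tends both to the residual of \<open>U\<close> and to zero.\<close>
  proof (rule tendsto_unique)
    show "at_right (0::real) \<noteq> bot" by simp
    show "((\<lambda>\<epsilon>. residual (mean_intensity (I \<epsilon>)) n i) \<longlongrightarrow> residual U n i) (at_right 0)"
      unfolding five_point_residual_def using c \<Delta>t \<Delta>x \<sigma>\<^sub>s by (intro tendsto_intros U) auto
    have "((\<lambda>\<epsilon>. residual (I \<epsilon> 0) n i) \<longlongrightarrow> 0) (at_right 0)"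
      by (rule residual_tendsto_zero[where I = I, OF scheme bound hat]) (use that in auto)
    then show "((\<lambda>\<epsilon>. residual (mean_intensity (I \<epsilon>)) n i) \<longlongrightarrow> 0) (at_right 0)"
      unfolding residual_mean_intensity by (rule tendsto_divide_zero)
  qed
  with U show ?thesis1 by blast
qed

end

theorem theorem2:
  fixes c \<sigma>\<^sub>s \<sigma>\<^sub>a \<Delta>x \<Delta>t :: real and M :: nat
  assumes "c > 0" and "\<sigma>\<^sub>s > 0" and "\<sigma>\<^sub>a \<ge> 0" and "\<Delta>x > 0" and "\<Delta>t > 0" and "M \<ge> 1"
  shows
    "\<comment> \<open>any mesh, any boundary treatment, values bounded as \<epsilon> tends to 0\<close>
     (\<forall>C I. (\<forall>\<epsilon>>0. imex_pn_scheme c \<sigma>\<^sub>s \<sigma>\<^sub>a \<Delta>x \<Delta>t M \<epsilon> C (I \<epsilon>))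
         \<and> (\<forall>n i. \<exists>K. \<forall>\<^sub>F \<epsilon> in at_right 0.
               \<bar>I1_hat \<epsilon> (I \<epsilon>) n i\<bar> \<le> K \<and> (\<forall>l\<le>M. \<bar>I \<epsilon> l n i\<bar> \<le> K))
       \<longrightarrow> (\<forall>n i. (n \<ge> 1 \<or> (\<forall>j\<in>C. ((\<lambda>\<epsilon>. I \<epsilon> 2 0 j) \<longlongrightarrow> 0) (at_right 0))) \<and> {i - 2..i + 2} \<subseteq> C
             \<longrightarrow> ((\<lambda>\<epsilon>. five_point_residual c \<sigma>\<^sub>s \<sigma>\<^sub>a \<Delta>x \<Delta>t (mean_intensity (I \<epsilon>)) n i) \<longlongrightarrow> 0)
                   (at_right 0)))
     \<and>
     \<comment> \<open>unbounded mesh: only the initial data are assumed to be bounded and to converge\<close>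
     (\<forall>I g. (\<forall>\<epsilon>>0. imex_pn_scheme c \<sigma>\<^sub>s \<sigma>\<^sub>a \<Delta>x \<Delta>t M \<epsilon> UNIV (I \<epsilon>))
         \<and> (\<forall>\<epsilon>>0. \<forall>l\<le>M. \<forall>n. bounded (range (I \<epsilon> l n)))
         \<and> (\<exists>K. \<forall>\<^sub>F \<epsilon> in at_right 0. \<forall>l\<le>M. \<forall>i. \<bar>I \<epsilon> l 0 i\<bar> \<le> K)
         \<and> (\<forall>l\<le>M. \<forall>i. ((\<lambda>\<epsilon>. I \<epsilon> l 0 i) \<longlongrightarrow> g l i) (at_right 0))
       \<longrightarrow> (\<exists>U. (\<forall>n i. ((\<lambda>\<epsilon>. mean_intensity (I \<epsilon>) n i) \<longlongrightarrow> U n i) (at_right 0))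
               \<and> (\<forall>n i. n \<ge> 1 \<or> (\<forall>j. ((\<lambda>\<epsilon>. I \<epsilon> 2 0 j) \<longlongrightarrow> 0) (at_right 0)) \<longrightarrow>
                     five_point_residual c \<sigma>\<^sub>s \<sigma>\<^sub>a \<Delta>x \<Delta>t U n i = 0))
           \<and> (\<forall>l\<in>{1..M}. \<forall>n\<ge>1. \<forall>i. ((\<lambda>\<epsilon>. I \<epsilon> l n i) \<longlongrightarrow> 0) (at_right 0)))
     \<and>
     \<comment> \<open>the limit scheme is a scheme for the diffusion limit equation\<close>
     consistent_with (five_point_residual c \<sigma>\<^sub>s \<sigma>\<^sub>a) (diffusion_residual c \<sigma>\<^sub>s \<sigma>\<^sub>a)"
proof -
  interpret imex_pn c \<sigma>\<^sub>s \<sigma>\<^sub>a \<Delta>x \<Delta>t M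
    using assms by unfold_locales
  have bounded_case: "((\<lambda>\<epsilon>. residual (mean_intensity (I \<epsilon>)) n i) \<longlongrightarrow> 0) (at_right 0)"
    if scheme: "\<And>\<epsilon>. \<epsilon> > 0 \<Longrightarrow> scheme \<epsilon> C (I \<epsilon>)"
      and bound: "\<And>n i. \<exists>K. \<forall>\<^sub>F \<epsilon> in at_right 0.
        \<bar>I1_hat \<epsilon> (I \<epsilon>) n i\<bar> \<le> K \<and> (\<forall>l\<le>M. \<bar>I \<epsilon> l n i\<bar> \<le> K)"
      and prepared: "n \<ge> 1 \<or> (\<forall>j\<in>C. ((\<lambda>\<epsilon>. I \<epsilon> 2 0 j) \<longlongrightarrow> 0) (at_right 0))"
      and C: "{i - 2..i + 2} \<subseteq> C" for C I i and n :: nat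
  proof -
    have moment: "\<exists>K. \<forall>\<^sub>F \<epsilon> in at_right 0. \<bar>I \<epsilon> l n i\<bar> \<le> K" if "l \<le> M" for l n i
      using bound[of n i] that by (auto elim!: eventually_mono)
    have hat: "\<exists>K. \<forall>\<^sub>F \<epsilon> in at_right 0. \<bar>I1_hat \<epsilon> (I \<epsilon>) (n + 1) i\<bar> \<le> K" for i
      using bound[of "n + 1" i] by (auto elim!: eventually_mono)
    have "((\<lambda>\<epsilon>. residual (I \<epsilon> 0) n i) \<longlongrightarrow> 0) (at_right 0)"
      by (rule residual_tendsto_zero[where I = I, OF scheme moment hat C prepared])
    \<comment> \<open>The residual is homogeneous in the grid function, so the factor one half in
      the mean intensity is harmless.\<close>
    then show ?thesis
      unfolding residual_mean_intensity by (rule tendsto_divide_zero)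
  qed
  show ?thesis
  proof (intro conjI allI impI)
    fix C I i and n :: nat
    assume "(\<forall>\<epsilon>>0. scheme \<epsilon> C (I \<epsilon>)) \<and> (\<forall>n i. \<exists>K. \<forall>\<^sub>F \<epsilon> in at_right 0.
        \<bar>I1_hat \<epsilon> (I \<epsilon>) n i\<bar> \<le> K \<and> (\<forall>l\<le>M. \<bar>I \<epsilon> l n i\<bar> \<le> K))"
      and "(n \<ge> 1 \<or> (\<forall>j\<in>C. ((\<lambda>\<epsilon>. I \<epsilon> 2 0 j) \<longlongrightarrow> 0) (at_right 0))) \<and> {i - 2..i + 2} \<subseteq> C"
    then show "((\<lambda>\<epsilon>. residual (mean_intensity (I \<epsilon>)) n i) \<longlongrightarrow> 0) (at_right 0)"
      by (intro bounded_case[where C = C]) auto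
  next
    fix I g
    assume hyps: "(\<forall>\<epsilon>>0. scheme \<epsilon> UNIV (I \<epsilon>))
      \<and> (\<forall>\<epsilon>>0. \<forall>l\<le>M. \<forall>n. bounded (range (I \<epsilon> l n)))
      \<and> (\<exists>K. \<forall>\<^sub>F \<epsilon> in at_right 0. \<forall>l\<le>M. \<forall>i. \<bar>I \<epsilon> l 0 i\<bar> \<le> K)
      \<and> (\<forall>l\<le>M. \<forall>i. ((\<lambda>\<epsilon>. I \<epsilon> l 0 i) \<longlongrightarrow> g l i) (at_right 0))"
    show "\<exists>U. (\<forall>n i. ((\<lambda>\<epsilon>. mean_intensity (I \<epsilon>) n i) \<longlongrightarrow> U n i) (at_right 0))
        \<and> (\<forall>n i. n \<ge> 1 \<or> (\<forall>j. ((\<lambda>\<epsilon>. I \<epsilon> 2 0 j) \<longlongrightarrow> 0) (at_right 0)) \<longrightarrow> residual U n i = 0)"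
      by (rule unbounded_mesh_limit(1)[where I = I and g = g]) (use hyps in auto)
    show "\<forall>l\<in>{1..M}. \<forall>n\<ge>1. \<forall>i. ((\<lambda>\<epsilon>. I \<epsilon> l n i) \<longlongrightarrow> 0) (at_right 0)"
      by (intro ballI allI impI unbounded_mesh_limit(2)[where I = I and g = g]) (use hyps in auto)
  next
    show "consistent_with (five_point_residual c \<sigma>\<^sub>s \<sigma>\<^sub>a) (diffusion_residual c \<sigma>\<^sub>s \<sigma>\<^sub>a)"
      by (rule five_point_consistent)
  qed
qed

end
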